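(* Let $1\le k\le n$ be integers, let $f:[0,\infty)\to(0,\infty)$ be continuous with a finite upper bound $M_f$ on $[0,\infty)$, and let $g:(-\infty,0]\to(0,\infty)$ be continuous. Consider the equation $$-u_t\,\bigl(\sigma_k(\lambda(D^2u))\bigr)^{\alpha}=f(|x|)\,g(t)\quad\text{in }\mathbb{R}^{n+1}_-:=\mathbb{R}^n\times(-\infty,0].\qquad( * )$$ (i) If $\alpha>0$, then $( * )$ has a positive classical parabolically $k$-convex solution of the form $u(x,t)=w(t)v(r)$, $r=|x|$; that is, there exist a decreasing function $w(t)$ on $(-\infty,0]$ and a $k$-convex function $V(x)=v(|x|)$ on $\mathbb{R}^n$ such that $u(x,t)=w(t)v(|x|)>0$ is a classical solution of $( * )$ on $\mathbb{R}^{n+1}_-$. (ii) If $-1/k<\alpha<0$, then $( * )$ admits no positive classical parabolically $k$-convex entire solution of the form $u(x,t)=w(t)v(|x|)$.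
   Context: $\sigma_k(\lambda)=\sum_{1\le i_1<\cdots<i_k\le n}\lambda_{i_1}\cdots\lambda_{i_k}$ is the $k$-th elementary symmetric function of $\lambda=(\lambda_1,\dots,\lambda_n)$, and $\lambda(D^2u)$ denotes the eigenvalues of the Hessian matrix $D^2u$ of $u$ with respect to $x$. A classical solution is one that is $C^2$ in $x$ and $C^1$ in $t$ (one-sided at $t=0$) and satisfies the equation pointwise. "Entire" means defined on all of $\mathbb{R}^{n+1}_-$. A $C^2$ function $V$ on $\mathbb{R}^n$ is $k$-convex if $\sigma_j(\lambda(D^2V))>0$ for all $1\le j\le k$. A function $u(x,t)$ is parabolically $k$-convex if it is decreasing in $t$ and $k$-convex in $x$; for $u=w(t)v(|x|)$ of the separated form this means that $w$ is decreasing and $V(x)=v(|x|)$ is $k$-convex. *)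

theory Defs
  imports "HOL-Analysis.Analysis" "HOL-Computational_Algebra.Polynomial"
begin

text \<open>The sum over \<open>i\<^sub>1 < \<dots> < i\<^sub>k\<close> is taken over the \<open>k\<close>-element sets of list positions.\<close>

definition elem_sym :: "nat \<Rightarrow> real list \<Rightarrow> real" where
  "elem_sym k xs = (\<Sum>S | S \<subseteq> {..<length xs} \<and> card S = k. \<Prod>i\<in>S. xs ! i)"

definition charpoly :: "real^'n^'n \<Rightarrow> real poly" where
  "charpoly A = det (mat [:0, 1:] - (\<chi> i j. [:A $ i $ j:]))"

text \<open>
  The real eigenvalues in increasing order, repeated according to algebraic multiplicity.  For a
  symmetric matrix, in particular for the Hessian of a \<open>C\<^sup>2\<close> function, the list has length
  \<open>CARD('n)\<close>.
\<close>

definition eigenvalues :: "real^'n^'n \<Rightarrow> real list" where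
  "eigenvalues A = sorted_list_of_multiset (proots (charpoly A))"

definition gradient :: "(real^'n \<Rightarrow> real) \<Rightarrow> real^'n \<Rightarrow> real^'n" where
  "gradient V x = (\<chi> i. frechet_derivative V (at x) (axis i 1))"

definition hessian :: "(real^'n \<Rightarrow> real) \<Rightarrow> real^'n \<Rightarrow> real^'n^'n" where
  "hessian V x = jacobian (gradient V) (at x)"

definition C2 :: "(real^'n \<Rightarrow> real) \<Rightarrow> bool" where
  "C2 V \<longleftrightarrow> V differentiable_on UNIV \<and> gradient V differentiable_on UNIV \<and>
     continuous_on UNIV (hessian V)"

definition k_convex :: "nat \<Rightarrow> (real^'n \<Rightarrow> real) \<Rightarrow> bool" where
  "k_convex k V \<longleftrightarrow> C2 V \<and> (\<forall>x. \<forall>j\<in>{1..k}. elem_sym j (eigenvalues (hessian V x)) > 0)"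

text \<open>
  Functions on \<open>\<real>\<^sup>n \<times> (-\<infinity>, 0]\<close> are curried, and their values at times \<open>t > 0\<close> are irrelevant:
  time derivatives are taken within \<open>{..0}\<close>, hence are one-sided at \<open>t = 0\<close>.
\<close>

definition time_deriv :: "(real^'n \<Rightarrow> real \<Rightarrow> real) \<Rightarrow> real^'n \<Rightarrow> real \<Rightarrow> real" where
  "time_deriv u x t = vector_derivative (u x) (at t within {..0})"

definition parabolically_k_convex :: "nat \<Rightarrow> (real^'n \<Rightarrow> real \<Rightarrow> real) \<Rightarrow> bool" where
  "parabolically_k_convex k u \<longleftrightarrow>
     (\<forall>x. strict_antimono_on {..0} (u x)) \<and> (\<forall>t\<le>0. k_convex k (\<lambda>x. u x t))"

text \<open>
  The power is only meaningful for a positive base; this holds for every parabolically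
  \<open>k\<close>-convex \<open>u\<close> when \<open>k \<ge> 1\<close>.
\<close>

definition classical_solution ::
  "nat \<Rightarrow> real \<Rightarrow> (real \<Rightarrow> real) \<Rightarrow> (real \<Rightarrow> real) \<Rightarrow> (real^'n \<Rightarrow> real \<Rightarrow> real) \<Rightarrow> bool" where
  "classical_solution k \<alpha> f g u \<longleftrightarrow>
     (\<forall>t\<le>0. C2 (\<lambda>x. u x t)) \<and>
     (\<forall>x. u x differentiable_on {..0} \<and> continuous_on {..0} (time_deriv u x)) \<and>
     (\<forall>x. \<forall>t\<le>0. - time_deriv u x t * elem_sym k (eigenvalues (hessian (\<lambda>y. u y t) x)) powr \<alpha>
                   = f (norm x) * g t)"

definition separated :: "(real \<Rightarrow> real) \<Rightarrow> (real \<Rightarrow> real) \<Rightarrow> real^'n \<Rightarrow> real \<Rightarrow> real" where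
  "separated w v x t = w t * v (norm x)"

end

theory Submission
  imports Defs
begin

text \<open>
  For a radial function with \<open>\<nabla>V(x) = p(|x|) x\<close>, the Hessian at \<open>|x| = r\<close> has the eigenvalue \<open>p\<close>
  with multiplicity \<open>n - 1\<close> and the simple radial eigenvalue \<open>p + r p'\<close>, whence
  \<open>\<sigma>\<^sub>j(D\<^sup>2V) = (n choose j) p\<^bsup>j-1\<^esup> (p + (j/n) r p')\<close> and, in divergence form,
  \<open>n r\<^bsup>n-1\<^esup> \<sigma>\<^sub>j(D\<^sup>2V) = (n choose j) (r\<^sup>n p\<^sup>j)'\<close> (lemmas
  \<open>elem_sym_radial_hessian\<close> and \<open>DERIV_radial_divergence\<close>).  Both halves of the theorem are statements
  about this scalar expression.

  For \<open>\<alpha> > 0\<close>, separation of variables leaves an explicitly solvable equation for \<open>w\<close> and the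
  equation \<open>\<sigma>\<^sub>k(D\<^sup>2V) = (f / V)\<^bsup>1/\<alpha>\<^esup>\<close> for \<open>V\<close>.  In divergence form the latter says that \<open>p\<^sup>k\<close> is, up to a
  constant, the mean of \<open>(f / V)\<^bsup>1/\<alpha>\<^esup>\<close> over the ball of radius \<open>r\<close>.  With \<open>V(x) = G(|x|\<^sup>2)\<close>, this is a
  Volterra equation for \<open>G\<close> whose kernel is locally Lipschitz as long as \<open>V\<close> is bounded and bounded away
  from \<open>0\<close>.  Starting from \<open>G(0) = 1\<close>, the function \<open>G\<close> increases, and since \<open>f\<close> is bounded it grows at
  most linearly.  So Picard iteration converges on the whole half line (lemmas \<open>volterra_fixed_point\<close>
  and \<open>radial_profile_exists\<close>).  The \<open>\<sigma>\<^sub>j\<close> with \<open>j < k\<close> are then positive because \<open>p + (j/n) r p'\<close> lies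
  between \<open>p\<close> and \<open>p + (k/n) r p'\<close>.

  For \<open>-1/k < \<alpha> < 0\<close>, the equation at the single time \<open>t = 0\<close> gives \<open>\<sigma>\<^sub>k(D\<^sup>2V) \<ge> K V\<^bsup>\<beta>\<^esup>\<close> with
  \<open>\<beta> = -1/\<alpha> > k\<close> for the positive \<open>k\<close>-convex radial function \<open>V = u(x, 0)\<close>.  Such a superlinear
  inequality has no entire solution: \<open>V\<close> increases with \<open>r\<close>, and the distance in which it doubles
  decays geometrically, so that \<open>V\<close> would become infinite at a finite radius (lemmas
  \<open>no_entire_k_convex_radial_supersolution\<close> and \<open>no_global_superlinear_growth\<close>).
\<close>

section \<open>Elementary symmetric functions of the spectrum of a rank-one perturbation\<close>

lemma prod_linear_monom:
  fixes g :: "'b \<Rightarrow> 'a::comm_semiring_1"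
  shows "finite X \<Longrightarrow> (\<Prod>i\<in>X. monom (g i) (Suc 0)) = monom (\<Prod>i\<in>X. g i) (card X)"
  by (induction X rule: finite_induct) (auto simp: mult_monom)

text \<open>
  The generating polynomial \<open>\<Prod>(1 + x X)\<close> depends only on the multiset of the entries, so that
  the order in which the eigenvalues are listed becomes irrelevant.
\<close>
lemma elem_sym_eq_coeff: "elem_sym k xs = coeff (\<Prod>x\<leftarrow>xs. [:1, x:]) k"
proof -
  let ?A = "{..<length xs}"
  have "(\<Prod>x\<leftarrow>xs. [:1, x:]) = (\<Prod>i\<in>?A. monom (xs ! i) (Suc 0) + 1)"
    by (subst prod.list_conv_set_nth)
      (auto simp: monom_Suc monom_0 one_pCons atLeast0LessThan)
  also have "\<dots> = (\<Sum>X\<in>Pow ?A. monom (\<Prod>i\<in>X. xs ! i) (card X))"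
    by (subst prod_add) (auto intro!: sum.cong prod_linear_monom finite_subset[of _ ?A])
  finally have "coeff (\<Prod>x\<leftarrow>xs. [:1, x:]) k
      = (\<Sum>X\<in>Pow ?A. if card X = k then \<Prod>i\<in>X. xs ! i else 0)"
    by (simp add: coeff_sum)
  also have "\<dots> = (\<Sum>X\<in>{X \<in> Pow ?A. card X = k}. \<Prod>i\<in>X. xs ! i)"
    by (rule sum.inter_filter[symmetric]) auto
  finally show ?thesis
    by (simp add: elem_sym_def)
qed

lemma elem_sym_cong_mset:
  assumes "mset xs = mset ys"
  shows "elem_sym k xs = elem_sym k ys"
  unfolding elem_sym_eq_coeff using assms by (metis mset_map prod_mset_prod_list)

lemma elem_sym_Cons:
  "elem_sym (Suc k) (x # xs) = elem_sym (Suc k) xs + x * elem_sym k xs"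
  by (simp add: elem_sym_eq_coeff)

lemma elem_sym_replicate: "elem_sym k (replicate m a) = of_nat (m choose k) * a ^ k"
proof -
  have "elem_sym k (replicate m a) = (\<Sum>S | S \<subseteq> {..<m} \<and> card S = k. a ^ k)"
    unfolding elem_sym_def by (intro sum.cong refl) (auto simp: subset_eq)
  then show ?thesis
    by (simp add: n_subsets)
qed

lemma elem_sym_mset_replicate:
  assumes "mset xs = replicate_mset m a + {#b#}" "j \<ge> 1"
  shows "elem_sym j xs = real (m choose j) * a ^ j + b * (real (m choose (j - 1)) * a ^ (j - 1))"
proof -
  have "elem_sym j xs = elem_sym j (b # replicate m a)"
    by (rule elem_sym_cong_mset) (simp add: assms)
  then show ?thesis using assms(2)
    by (cases j) (auto simp: elem_sym_Cons elem_sym_replicate)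
qed

lemma poly_det: "poly (det A) z = det (\<chi> i j. poly (A $ i $ j) z)"
  by (simp add: det_def poly_sum poly_prod of_int_poly)

lemma poly_charpoly: "poly (charpoly A) z = det (mat z - A)"
  unfolding charpoly_def poly_det
  by (rule arg_cong[of _ _ det]) (auto simp: vec_eq_iff mat_def)

definition outer :: "real^'n \<Rightarrow> real^'n^'n" where "outer x = (\<chi> i j. x $ i * x $ j)"

lemma outer_0 [simp]: "outer 0 = 0"
  by (simp add: outer_def vec_eq_iff)

lemma outer_mult_vec: "outer x *v y = (x \<bullet> y) *\<^sub>R x"
  by (simp add: outer_def matrix_vector_mult_def vec_eq_iff inner_vec_def sum_distrib_left
      sum_distrib_right mult_ac)

lemma conjugate_outer: "A ** outer x ** transpose A = outer (A *v x)"
proof -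
  have "(\<Sum>l\<in>UNIV. (\<Sum>m\<in>UNIV. A $ i $ m * (x $ m * x $ l)) * A $ j $ l)
      = (\<Sum>m\<in>UNIV. A $ i $ m * x $ m) * (\<Sum>l\<in>UNIV. A $ j $ l * x $ l)" for i j
    by (subst sum_product) (subst sum.swap, simp add: sum_distrib_left sum_distrib_right mult_ac)
  then show ?thesis
    by (simp add: vec_eq_iff outer_def matrix_matrix_mult_def matrix_vector_mult_def transpose_def)
qed

lemma matrix_matrix_mult_add: "(A + B) ** C = A ** C + B ** (C :: real^'n^'m)"
  by (simp add: matrix_matrix_mult_def vec_eq_iff algebra_simps sum.distrib)

text \<open>
  An orthogonal matrix that takes a basis vector to \<open>x\<close> conjugates the matrix to a diagonal one, with
  \<open>a + b\<close> in one place and \<open>a\<close> in all others.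
\<close>
lemma det_scalar_plus_outer:
  fixes x :: "real^'n"
  assumes "norm x = 1"
  shows "det (mat a + b *\<^sub>R outer x) = a ^ (CARD('n) - 1) * (a + b)"
proof -
  obtain k :: 'n where True by simp
  obtain Q where Q: "orthogonal_matrix Q" "Q *v axis k 1 = x"
    using orthogonal_matrix_exists_basis[OF assms, of k] by metis
  define D :: "real^'n^'n" where "D = mat a + b *\<^sub>R outer (axis k 1)"
  have QQ: "Q ** transpose Q = mat 1" using Q(1) by (simp add: orthogonal_matrix_def)
  have 1: "Q ** outer (axis k 1) ** transpose Q = outer x"
    by (simp add: conjugate_outer Q(2))
  have "Q ** D ** transpose Q = mat a + b *\<^sub>R outer x"
  proof -
    have D: "D = a *\<^sub>R mat 1 + b *\<^sub>R outer (axis k 1)"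
      by (auto simp: D_def vec_eq_iff mat_def)
    have "Q ** D ** transpose Q
        = a *\<^sub>R (Q ** transpose Q) + b *\<^sub>R (Q ** outer (axis k 1) ** transpose Q)"
      unfolding D by (simp add: matrix_add_ldistrib matrix_matrix_mult_add matrix_scalar_ac
          flip: scalar_matrix_assoc)
    then show ?thesis
      unfolding 1 QQ by (auto simp: vec_eq_iff mat_def)
  qed
  then have "det (mat a + b *\<^sub>R outer x) = det Q * det D * det (transpose Q)"
    by (metis det_mul)
  also have "\<dots> = det D * det (Q ** transpose Q)"
    by (simp add: det_mul)
  also have "\<dots> = det D" by (simp add: QQ)
  also have "\<dots> = (\<Prod>i\<in>UNIV. D $ i $ i)"
    by (rule det_diagonal) (auto simp: D_def outer_def mat_def axis_def)
  also have "\<dots> = (a + b) * (\<Prod>i\<in>UNIV - {k}. a)"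
    by (subst prod.remove[of _ k]) (auto simp: D_def outer_def mat_def axis_def intro!: prod.cong)
  finally show ?thesis by (simp add: card_Diff_singleton mult.commute)
qed

text \<open>
  Real polynomials are equal if their values are, and the value at \<open>z\<close> is the determinant of
  \<open>(z - a) I - b x x\<^sup>T\<close>, a matrix of the same shape.
\<close>
lemma charpoly_scalar_plus_outer:
  fixes x :: "real^'n"
  assumes "norm x = 1"
  shows "charpoly (mat a + b *\<^sub>R outer x) = [:- a, 1:] ^ (CARD('n) - 1) * [:- (a + b), 1:]"
proof -
  have "poly (charpoly (mat a + b *\<^sub>R outer x)) z
      = poly ([:- a, 1:] ^ (CARD('n) - 1) * [:- (a + b), 1:]) z" for z
  proof -
    have "mat z - (mat a + b *\<^sub>R outer x) = mat (z - a) + (- b) *\<^sub>R outer x"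
      by (auto simp: vec_eq_iff mat_def)
    then show ?thesis
      using det_scalar_plus_outer[OF assms, of "z - a" "- b"]
      by (simp only: poly_charpoly) (simp add: algebra_simps)
  qed
  then show ?thesis
    by (simp add: poly_eq_poly_eq_iff[symmetric] fun_eq_iff del: mult_pCons_left mult_pCons_right)
qed

text \<open>
  Sorting the \<open>j\<close>-subsets of the eigenvalues \<open>a, \<dots>, a, a + b\<close> by whether they contain \<open>a + b\<close> gives
  \<open>(n-1 choose j) a\<^sup>j + (n-1 choose j-1) a\<^bsup>j-1\<^esup> (a + b)\<close>.  The factored form below
  shows that, when \<open>a > 0\<close>, positivity for one \<open>j\<close> is a condition on \<open>a + (j/n) b\<close>, which is affine in \<open>j\<close>.
\<close>
lemma elem_sym_eigenvalues_scalar_plus_outer: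
  fixes x :: "real^'n"
  assumes "norm x = 1" "j \<ge> 1"
  shows "elem_sym j (eigenvalues (mat a + b *\<^sub>R outer x))
     = real (CARD('n) choose j) * a ^ (j - 1) * (a + real j / real CARD('n) * b)"
proof -
  have "proots (charpoly (mat a + b *\<^sub>R outer x)) = replicate_mset (CARD('n) - 1) a + {#a + b#}"
    unfolding charpoly_scalar_plus_outer[OF assms(1)]
    by (subst proots_mult) (auto simp: proots_power repeat_mset_replicate_mset)
  then have *: "mset (eigenvalues (mat a + b *\<^sub>R outer x)) = replicate_mset (CARD('n) - 1) a + {#a + b#}"
    by (simp add: eigenvalues_def)
  obtain m where m: "CARD('n) = Suc m" by (metis zero_less_card_finite gr0_implies_Suc)
  obtain i where i: "j = Suc i" using assms(2) by (cases j) auto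
  have "real (Suc i) * real (Suc m choose Suc i) = real (Suc m) * real (m choose i)"
    by (metis Suc_times_binomial_eq of_nat_mult mult.commute)
  then have "real (m choose i) = real (Suc i) / real (Suc m) * real (Suc m choose Suc i)"
    by (simp add: field_simps)
  moreover have "real (m choose Suc i) = real (Suc m choose Suc i) - real (m choose i)"
    by simp
  ultimately show ?thesis
    unfolding elem_sym_mset_replicate[OF * assms(2)] unfolding m i diff_Suc_1 power_Suc
    by (simp only:) (simp only: algebra_simps)
qed

section \<open>Hessians of radial functions\<close>

lemma gradient_eqI:
  assumes "(V has_derivative (\<lambda>h. g \<bullet> h)) (at x)"
  shows "gradient V x = g"
  using frechet_derivative_at[OF assms, symmetric]
  by (simp add: gradient_def vec_eq_iff inner_axis)

lemma hessian_eqI: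
  assumes "(gradient V has_derivative (\<lambda>h. A *v h)) (at x)"
  shows "hessian V x = A"
  using frechet_derivative_at[OF assms, symmetric]
  by (simp add: hessian_def jacobian_def)

lemma mat_mult_vec: "mat c *v h = c *\<^sub>R (h :: real^'n)"
  by (simp add: vec_eq_iff matrix_vector_mult_def mat_def if_distrib if_distribR cong: if_cong)

text \<open>
  A radial function has gradient \<open>p(|x|) x\<close>.  Its derivative is multiplication by \<open>p(r)\<close>
  tangentially to the sphere of radius \<open>r\<close> and by \<open>(r p(r))' = p(r) + r p'(r)\<close> in the radial direction.
\<close>
lemma has_derivative_radial_field:
  fixes x :: "real^'n"
  assumes "x \<noteq> 0" "(p has_real_derivative p') (at (norm x))"
  shows "((\<lambda>y. p (norm y) *\<^sub>R y) has_derivative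
           (\<lambda>h. (mat (p (norm x)) + (norm x * p') *\<^sub>R outer (sgn x)) *v h)) (at x)"
proof -
  have "((\<lambda>y. p (norm y)) has_derivative (\<lambda>h. p' * (h \<bullet> sgn x))) (at x)"
    using has_derivative_compose[OF has_derivative_norm[OF assms(1)]
        assms(2)[unfolded has_field_derivative_def]] .
  then have *: "((\<lambda>y. p (norm y) *\<^sub>R y) has_derivative
          (\<lambda>h. p (norm x) *\<^sub>R h + (p' * (h \<bullet> sgn x)) *\<^sub>R x)) (at x)"
    by (rule has_derivative_scaleR[OF _ has_derivative_ident])
  have **: "x = norm x *\<^sub>R sgn x"
    using assms(1) by (simp add: sgn_div_norm)
  have "p (norm x) *\<^sub>R h + (p' * (h \<bullet> sgn x)) *\<^sub>R x
      = (mat (p (norm x)) + (norm x * p') *\<^sub>R outer (sgn x)) *v h" for h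
  proof -
    have "(p' * (h \<bullet> sgn x)) *\<^sub>R x = (p' * (h \<bullet> sgn x)) *\<^sub>R (norm x *\<^sub>R sgn x)"
      using ** by (rule arg_cong)
    also have "\<dots> = (norm x * p') *\<^sub>R ((sgn x \<bullet> h) *\<^sub>R sgn x)"
      by (simp add: inner_commute mult_ac)
    finally show ?thesis
      by (simp only: matrix_vector_mult_add_rdistrib scaleR_matrix_vector_assoc[symmetric]
          outer_mult_vec mat_mult_vec)
  qed
  with * show ?thesis by simp
qed

text \<open>
  At the origin continuity of \<open>p\<close> suffices, because \<open>p(|y|) y - p(0) y = o(|y|)\<close>.
\<close>
lemma has_derivative_radial_field_0:
  fixes p :: "real \<Rightarrow> real"
  assumes "continuous_on {0..} p"
  shows "((\<lambda>y::real^'n. p (norm y) *\<^sub>R y) has_derivative (\<lambda>h. mat (p 0) *v h)) (at 0)"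
proof -
  have "continuous_on UNIV (\<lambda>y::real^'n. p (norm y))"
    by (rule continuous_on_compose2[OF assms continuous_on_norm_id]) auto
  then have "((\<lambda>y::real^'n. p (norm y) - p 0) \<longlongrightarrow> 0) (at 0)"
    by (intro LIM_zero) (auto simp: continuous_on_def dest!: spec[of _ 0])
  then have "((\<lambda>y::real^'n. norm (p (norm y) *\<^sub>R y - p 0 *\<^sub>R y) / norm y) \<longlongrightarrow> 0) (at 0)"
    by (rule Lim_null_comparison[rotated, OF tendsto_rabs_zero])
      (auto intro!: always_eventually simp: scaleR_diff_left[symmetric])
  then show ?thesis
    by (simp add: has_derivative_at mat_mult_vec bounded_linear_scaleR_right)
qed

text \<open>
  Writing a radial function as \<open>V(x) = G(|x|\<^sup>2)\<close> makes \<open>\<nabla>V(x) = p(|x|) x\<close>, where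
  \<open>p(r) = 2 G'(r\<^sup>2)\<close>, an instance of the chain rule at every point, the origin included; one-sided
  derivatives of \<open>G\<close> suffice because \<open>|x|\<^sup>2\<close> stays in \<open>{0..}\<close>.  The function \<open>q(r) = r p'(r)\<close> is
  the radial excess of the Hessian.  The direction \<open>sgn x\<close> has no limit at
  the origin; the Hessian is continuous there because \<open>q\<close> vanishes at \<open>0\<close>.
\<close>
lemma radial_C2:
  fixes G p q :: "real \<Rightarrow> real"
  defines "V \<equiv> (\<lambda>x::real^'n. G ((norm x)\<^sup>2))"
  assumes G: "\<And>s. s \<ge> 0 \<Longrightarrow> (G has_real_derivative p (sqrt s) / 2) (at s within {0..})"
    and p: "continuous_on {0..} p" "\<And>r. r > 0 \<Longrightarrow> (p has_real_derivative q r / r) (at r)"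
    and q: "continuous_on {0..} q" "q 0 = 0"
  shows "C2 V" and "hessian V x = mat (p (norm x)) + q (norm x) *\<^sub>R outer (sgn x)"
proof -
  have V: "(V has_derivative (\<lambda>h. (p (norm x) *\<^sub>R x) \<bullet> h)) (at x)" for x
  proof -
    have "(G has_derivative (\<lambda>h. p (sqrt s) / 2 * h)) (at s within {0..})" if "s \<in> {0..}" for s
      using G[of s] that by (simp only: has_field_derivative_def atLeast_iff)
    then have "(V has_derivative (\<lambda>h. p (sqrt (x \<bullet> x)) / 2 * (x \<bullet> h + h \<bullet> x))) (at x)"
      unfolding V_def power2_norm_eq_inner
      by (rule has_derivative_in_compose2)
        (auto intro: has_derivative_inner[OF has_derivative_ident has_derivative_ident])
    then show ?thesis
      by (simp add: norm_eq_sqrt_inner inner_commute)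
  qed
  then have grad: "gradient V = (\<lambda>x. p (norm x) *\<^sub>R x)"
    by (intro ext gradient_eqI)
  have H: "(gradient V has_derivative (\<lambda>h. (mat (p (norm x)) + q (norm x) *\<^sub>R outer (sgn x)) *v h)) (at x)" for x
  proof (cases "x = 0")
    case True
    then show ?thesis using has_derivative_radial_field_0[OF p(1)] by (simp add: grad)
  next
    case False
    then show ?thesis using has_derivative_radial_field[OF False p(2)] by (simp add: grad)
  qed
  then show hess: "hessian V x = mat (p (norm x)) + q (norm x) *\<^sub>R outer (sgn x)" for x
    by (rule hessian_eqI)
  have cp: "continuous_on UNIV (\<lambda>x::real^'n. p (norm x))"
    by (rule continuous_on_compose2[OF p(1) continuous_on_norm_id]) auto
  have cq: "continuous_on UNIV (\<lambda>x::real^'n. q (norm x))"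
    by (rule continuous_on_compose2[OF q(1) continuous_on_norm_id]) auto
  have "isCont (\<lambda>x::real^'n. q (norm x) * (sgn x $ i * sgn x $ j)) x" for i j x
  proof (cases "x = 0")
    case True
    have "((\<lambda>x::real^'n. q (norm x)) \<longlongrightarrow> 0) (at 0)"
      using cq q(2) by (auto simp: continuous_on_def dest!: spec[of _ 0])
    then have "((\<lambda>x::real^'n. q (norm x) * (sgn x $ i * sgn x $ j)) \<longlongrightarrow> 0) (at 0)"
    proof (rule Lim_null_comparison[rotated, OF tendsto_rabs_zero])
      have "\<bar>sgn x $ i * sgn x $ j\<bar> \<le> 1 * 1" for x :: "real^'n"
        unfolding abs_mult
        by (intro mult_mono) (auto intro!: order_trans[OF component_le_norm_cart] simp: norm_sgn)
      then show "\<forall>\<^sub>F x::real^'n in at 0. norm (q (norm x) * (sgn x $ i * sgn x $ j)) \<le> \<bar>q (norm x)\<bar>"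
        by (intro always_eventually allI) (auto simp: abs_mult mult_left_le)
    qed
    then show ?thesis using True by (simp add: isCont_def)
  next
    case False
    have "isCont (\<lambda>x. q (norm x)) x" using cq by (simp add: continuous_on_eq_continuous_at)
    moreover have "isCont (\<lambda>x. sgn x $ i) x" for i
      using False by (intro continuous_intros) auto
    ultimately show ?thesis by (intro continuous_mult)
  qed
  then have cent: "continuous_on UNIV (\<lambda>x::real^'n. q (norm x) * (sgn x $ i * sgn x $ j))" for i j
    by (simp add: continuous_at_imp_continuous_on)
  have "continuous_on UNIV (\<lambda>x::real^'n. \<chi> i j. (if i = j then p (norm x) else 0) + q (norm x) * (sgn x $ i * sgn x $ j))"
  proof (intro continuous_on_vec_lambda continuous_on_add cent)
    show "continuous_on UNIV (\<lambda>x::real^'n. if i = j then p (norm x) else 0)" for i j :: 'n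
      using cp by (cases "i = j") auto
  qed
  moreover have "(\<lambda>x::real^'n. \<chi> i j. (if i = j then p (norm x) else 0) + q (norm x) * (sgn x $ i * sgn x $ j)) = hessian V"
    unfolding hess by (auto simp: fun_eq_iff vec_eq_iff mat_def outer_def)
  ultimately have "continuous_on UNIV (hessian V)" by (simp only:)
  then show "C2 V"
    unfolding C2_def differentiable_on_def differentiable_def using V H by blast
qed

lemma elem_sym_radial_hessian:
  fixes x :: "real^'n"
  assumes "x = 0 \<longrightarrow> b = 0" "j \<ge> 1"
  shows "elem_sym j (eigenvalues (mat a + b *\<^sub>R outer (sgn x)))
     = real (CARD('n) choose j) * a ^ (j - 1) * (a + real j / real CARD('n) * b)"
proof (cases "x = 0")
  case True
  obtain k :: 'n where True by simp
  then show ?thesis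
    using elem_sym_eigenvalues_scalar_plus_outer[of "axis k 1" j a 0] True assms by (simp add: norm_axis_1)
next
  case False
  then show ?thesis using assms(2)
    by (intro elem_sym_eigenvalues_scalar_plus_outer) (auto simp: norm_sgn)
qed

section \<open>Blow-up of superlinear radial supersolutions\<close>

text \<open>
  In the step \<open>h(a) = (\<phi>(a)\<^bsup>k-\<beta>\<^esup> / \<kappa>)\<^bsup>1/(k+1)\<^esup>\<close> the growth hypothesis forces \<open>\<phi>\<close> to double.
  As \<open>\<beta> > k\<close>, the step is a negative power \<open>\<phi>(a)\<^bsup>-\<gamma>\<^esup>\<close> up to a constant, so the steps decay
  geometrically along the doublings and infinitely many of them fit into a bounded interval.
\<close>
lemma no_global_superlinear_growth:
  fixes \<phi> :: "real \<Rightarrow> real" and \<kappa> \<beta> :: real and k :: nat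
  assumes pos: "\<And>a. a \<ge> 1 \<Longrightarrow> \<phi> a > 0"
    and mono: "\<And>a b. 1 \<le> a \<Longrightarrow> a \<le> b \<Longrightarrow> \<phi> a \<le> \<phi> b"
    and growth: "\<And>a h. 1 \<le> a \<Longrightarrow> 0 < h \<Longrightarrow> \<kappa> * \<phi> a powr \<beta> * h ^ Suc k \<le> (\<phi> (a + h) - \<phi> a) ^ k"
    and "\<kappa> > 0" "\<beta> > real k" "k \<ge> 1"
  shows False
proof -
  define \<gamma> where "\<gamma> = (\<beta> - real k) / real (Suc k)"
  have \<gamma>: "\<gamma> > 0" using assms by (simp add: \<gamma>_def)
  define c where "c = \<kappa> powr (- 1 / real (Suc k))"
  define h where "h a = c * \<phi> a powr (- \<gamma>)" for a
  have c: "c > 0" using \<open>\<kappa> > 0\<close> by (simp add: c_def)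
  have h: "h a > 0" if "a \<ge> 1" for a using c pos[OF that] by (simp add: h_def)
  have double: "\<phi> (a + h a) \<ge> 2 * \<phi> a" if a: "a \<ge> 1" for a
  proof -
    have "c ^ Suc k = \<kappa> powr (- 1)"
      unfolding c_def using \<open>\<kappa> > 0\<close> by (subst powr_realpow[symmetric]) (auto simp: powr_powr)
    moreover have "(\<phi> a powr (- \<gamma>)) ^ Suc k = \<phi> a powr (real k - \<beta>)"
      unfolding \<gamma>_def using pos[OF a] by (subst powr_realpow[symmetric]) (auto simp: powr_powr)
    ultimately have "\<kappa> * \<phi> a powr \<beta> * h a ^ Suc k = (\<kappa> * \<kappa> powr (- 1)) * (\<phi> a powr \<beta> * \<phi> a powr (real k - \<beta>))"
      by (simp only: h_def power_mult_distrib mult_ac)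
    also have "\<dots> = \<phi> a ^ k"
      using \<open>\<kappa> > 0\<close> pos[OF a] by (simp add: powr_minus powr_realpow flip: powr_add)
    finally have "\<phi> a ^ k \<le> (\<phi> (a + h a) - \<phi> a) ^ k"
      using growth[OF a h[OF a]] by simp
    moreover have "\<phi> (a + h a) - \<phi> a \<ge> 0"
      using mono[OF a, of "a + h a"] h[OF a] by simp
    ultimately have "\<phi> a \<le> \<phi> (a + h a) - \<phi> a"
      using \<open>k \<ge> 1\<close> by (metis power_mono_iff pos[OF a] less_imp_le zero_less_one order_less_le_trans)
    then show ?thesis by simp
  qed
  define s where "s j = ((\<lambda>a. a + h a) ^^ j) 1" for j :: nat
  define z where "z = 2 powr (- \<gamma>)"
  have z: "0 < z" "z < 1" using \<gamma> by (auto simp: z_def powr_less_one)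
  have s_Suc: "s (Suc j) = s j + h (s j)" for j by (simp add: s_def)
  have s1: "s j \<ge> 1" for j
  proof (induction j)
    case (Suc j)
    then show ?case using h[of "s j"] by (simp add: s_Suc)
  qed (simp add: s_def)
  have big: "\<phi> (s j) \<ge> 2 ^ j * \<phi> 1" for j
  proof (induction j)
    case (Suc j)
    then show ?case using double[OF s1[of j]] by (simp add: s_Suc)
  qed (simp add: s_def)
  have step: "h (s j) \<le> h 1 * z ^ j" for j
  proof -
    have "\<phi> (s j) powr (- \<gamma>) \<le> (2 ^ j * \<phi> 1) powr (- \<gamma>)"
      using big[of j] pos[of 1] \<gamma> by (intro powr_mono2') auto
    also have "\<dots> = z ^ j * \<phi> 1 powr (- \<gamma>)"
      using pos[of 1] unfolding z_def
      by (simp add: powr_mult powr_powr powr_realpow[symmetric] mult.commute)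
    finally show ?thesis using c by (simp add: h_def mult_ac)
  qed
  have bound: "s j \<le> 1 + h 1 * (\<Sum>i<j. z ^ i)" for j
  proof (induction j)
    case (Suc j)
    then show ?case using step[of j] by (simp add: s_Suc algebra_simps)
  qed (simp add: s_def)
  define A where "A = 1 + h 1 * (1 / (1 - z))"
  have "s j \<le> A" for j
  proof -
    have "(\<Sum>i<j. z ^ i) \<le> 1 / (1 - z)"
      using z by (subst sum_gp_strict) (auto intro!: divide_right_mono)
    then show ?thesis using bound[of j] h[of 1] unfolding A_def
      by (smt (verit) mult_left_mono)
  qed
  then have "2 ^ j * \<phi> 1 \<le> \<phi> A" for j
    using big[of j] mono[OF s1[of j], of A] by (meson order_trans)
  moreover obtain j where "\<phi> A / \<phi> 1 < 2 ^ j"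
    using real_arch_pow[of 2 "\<phi> A / \<phi> 1"] by auto
  ultimately show False
    using pos[of 1] by (simp add: divide_less_eq) (meson not_less)
qed

lemma has_derivative_gradient:
  fixes V :: "real^'n \<Rightarrow> real"
  assumes "V differentiable (at x)"
  shows "(V has_derivative (\<lambda>h. gradient V x \<bullet> h)) (at x)"
proof -
  obtain D where D: "(V has_derivative D) (at x)"
    using assms by (auto simp: differentiable_def)
  have "D h = adjoint D 1 \<bullet> h" for h
    using adjoint_works[OF has_derivative_linear[OF D], of h 1] by (simp add: inner_commute)
  then have "(V has_derivative (\<lambda>h. adjoint D 1 \<bullet> h)) (at x)"
    using D by (metis ext)
  with gradient_eqI[OF this] show ?thesis by simp
qed

text \<open>
  The radial structure is recovered from \<open>V\<close> by restriction to a line through the origin: along the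
  line, \<open>V\<close> is an even function with derivative \<open>\<psi>\<close>, whence \<open>\<psi>(0) = 0\<close>, and \<open>\<phi>' = \<psi>\<close> for positive
  arguments.  Twice differentiability of \<open>\<phi>\<close> follows from that of \<open>V\<close>.
\<close>
lemma radial_C2_profile:
  fixes \<phi> :: "real \<Rightarrow> real" and i :: "'n::finite"
  defines "V \<equiv> (\<lambda>x::real^'n. \<phi> (norm x))" and "e \<equiv> axis i 1"
  assumes "C2 V"
  obtains \<psi> \<psi>' where
    "\<And>r. r > 0 \<Longrightarrow> (\<phi> has_real_derivative \<psi> r) (at r)"
    "\<And>r. (\<psi> has_real_derivative \<psi>' r) (at r)" "\<psi> 0 = 0"
    "\<And>r. r > 0 \<Longrightarrow> hessian V (r *\<^sub>R e) = mat (\<psi> r / r) + (\<psi>' r - \<psi> r / r) *\<^sub>R outer (sgn (r *\<^sub>R e))"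
proof -
  define \<psi> where "\<psi> r = gradient V (r *\<^sub>R e) \<bullet> e" for r
  have V: "(V has_derivative (\<lambda>h. gradient V x \<bullet> h)) (at x)" for x
    using assms(3) by (intro has_derivative_gradient) (auto simp: C2_def differentiable_on_def)
  have gV: "gradient V differentiable (at x)" for x
    using assms(3) by (auto simp: C2_def differentiable_on_def)
  have e: "norm e = 1" by (simp add: e_def)
  have line: "((\<lambda>r. r *\<^sub>R e) has_derivative (\<lambda>h. h *\<^sub>R e)) (at r)" for r
    by (intro derivative_intros)
  have Phi: "((\<lambda>r. V (r *\<^sub>R e)) has_real_derivative \<psi> r) (at r)" for r
    using has_derivative_compose[OF line V, of r]
    by (simp add: has_field_derivative_def \<psi>_def mult.commute[of _ "gradient V (r *\<^sub>R e) \<bullet> e"] fun_eq_iff)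
  have phi: "(\<phi> has_real_derivative \<psi> r) (at r)" if "r > 0" for r
    by (rule has_field_derivative_transform_within_open[OF Phi, of "{0<..}"])
      (use that e in \<open>auto simp: V_def\<close>)
  have neg: "((\<lambda>r. V (r *\<^sub>R e)) has_real_derivative - \<psi> 0) (at 0)"
    using DERIV_chain2[of "\<lambda>r. V (r *\<^sub>R e)" "\<psi> 0" uminus 0 "-1" UNIV] Phi[of 0]
      DERIV_minus[OF DERIV_ident, of "0 :: real" UNIV]
    by (simp add: V_def)
  have psi0: "\<psi> 0 = 0"
    using DERIV_unique[OF Phi[of 0] neg] by simp
  have "\<psi> differentiable (at r)" for r
  proof -
    obtain D where "(gradient V has_derivative D) (at (r *\<^sub>R e))"
      using gV by (auto simp: differentiable_def)
    from has_derivative_inner_left[OF has_derivative_compose[OF line this], of e]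
    show ?thesis unfolding \<psi>_def[abs_def] differentiable_def by blast
  qed
  then obtain \<psi>' where psi: "(\<psi> has_real_derivative \<psi>' r) (at r)" for r
    by (metis real_differentiable_def)
  have grad: "gradient V x = (\<psi> (norm x) / norm x) *\<^sub>R x" if "x \<noteq> 0" for x
  proof (rule gradient_eqI)
    show "(V has_derivative (\<lambda>h. (\<psi> (norm x) / norm x) *\<^sub>R x \<bullet> h)) (at x)"
      unfolding V_def
      using has_derivative_compose[OF has_derivative_norm[OF that] phi[of "norm x", unfolded has_field_derivative_def]] that
      by (simp add: sgn_div_norm inner_commute divide_inverse mult_ac)
  qed
  have hess: "hessian V (r *\<^sub>R e) = mat (\<psi> r / r) + (\<psi>' r - \<psi> r / r) *\<^sub>R outer (sgn (r *\<^sub>R e))" if r: "r > 0" for r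
  proof (rule hessian_eqI)
    have nr: "norm (r *\<^sub>R e) = r" "r *\<^sub>R e \<noteq> 0" using r e by auto
    have "((\<lambda>r. \<psi> r / r) has_real_derivative (\<psi>' r * r - \<psi> r) / (r * r)) (at r)"
      using r by (auto intro!: derivative_eq_intros psi)
    then have "((\<lambda>y. (\<psi> (norm y) / norm y) *\<^sub>R y) has_derivative
      (\<lambda>h. (mat (\<psi> r / r) + (r * ((\<psi>' r * r - \<psi> r) / (r * r))) *\<^sub>R outer (sgn (r *\<^sub>R e))) *v h)) (at (r *\<^sub>R e))"
      by (rule has_derivative_radial_field[OF nr(2), where p = "\<lambda>r. \<psi> r / r", unfolded nr(1)])
    moreover have "r * ((\<psi>' r * r - \<psi> r) / (r * r)) = \<psi>' r - \<psi> r / r"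
      using r by (simp add: field_simps)
    ultimately have "((\<lambda>y. (\<psi> (norm y) / norm y) *\<^sub>R y) has_derivative
      (\<lambda>h. (mat (\<psi> r / r) + (\<psi>' r - \<psi> r / r) *\<^sub>R outer (sgn (r *\<^sub>R e))) *v h)) (at (r *\<^sub>R e))"
      by simp
    then show "(gradient V has_derivative
      (\<lambda>h. (mat (\<psi> r / r) + (\<psi>' r - \<psi> r / r) *\<^sub>R outer (sgn (r *\<^sub>R e))) *v h)) (at (r *\<^sub>R e))"
      by (rule has_derivative_transform_within_open[of _ _ _ _ "- {0}"]) (use nr grad in auto)
  qed
  show thesis using phi psi psi0 hess by (rule that)
qed

text \<open>
  The divergence form of the radial \<open>\<sigma>\<^sub>j\<close>: up to the factor \<open>(n choose j)\<close>, the right-hand side is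
  \<open>n r\<^bsup>n-1\<^esup> \<sigma>\<^sub>j\<close> for a Hessian with tangential eigenvalues \<open>\<psi>/r\<close> and radial eigenvalue \<open>\<psi>'\<close>.
\<close>
lemma DERIV_radial_divergence:
  fixes \<psi> :: "real \<Rightarrow> real"
  assumes "(\<psi> has_real_derivative \<psi>') (at r)" "r > 0" "1 \<le> j" "j \<le> n"
  shows "((\<lambda>r. r ^ (n - j) * \<psi> r ^ j) has_real_derivative
      real n * r ^ (n - 1) * ((\<psi> r / r) ^ (j - 1) * (\<psi> r / r + real j / real n * (\<psi>' - \<psi> r / r)))) (at r)"
proof -
  define p where "p = \<psi> r / r"
  have psi: "\<psi> r = r * p" using assms(2) by (simp add: p_def)
  obtain i where i: "j = Suc i" using assms(3) by (cases j) auto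
  obtain m where m: "n = j + m" using assms(4) le_Suc_ex by blast
  have "((\<lambda>r. r ^ m * \<psi> r ^ Suc i) has_real_derivative
      real m * r ^ (m - 1) * \<psi> r ^ Suc i + r ^ m * (real (Suc i) * \<psi> r ^ i * \<psi>')) (at r)"
    using DERIV_mult[OF DERIV_pow[of m r] DERIV_power_Suc[OF assms(1), of i]]
    by (simp add: algebra_simps)
  moreover have "real m * r ^ (m - 1) * \<psi> r ^ Suc i + r ^ m * (real (Suc i) * \<psi> r ^ i * \<psi>')
      = real n * r ^ (n - 1) * (p ^ i * (p + real (Suc i) / real n * (\<psi>' - p)))"
  proof -
    have n: "n - 1 = m + i" "real n = real m + real (Suc i)" by (simp_all add: m i)
    have 1: "real m * r ^ (m - 1) * \<psi> r ^ Suc i = real m * r ^ (m + i) * p ^ Suc i"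
      unfolding psi by (cases m) (simp_all add: power_mult_distrib power_add mult_ac)
    have 2: "r ^ m * (real (Suc i) * \<psi> r ^ i * \<psi>') = real (Suc i) * r ^ (m + i) * p ^ i * \<psi>'"
      unfolding psi by (simp add: power_mult_distrib power_add mult_ac)
    have 3: "real n * (p ^ i * (p + real (Suc i) / real n * (\<psi>' - p)))
        = p ^ i * (real n * p + real (Suc i) * (\<psi>' - p))"
      by (simp add: m i field_simps)
    have "real m * r ^ (m + i) * p ^ Suc i + real (Suc i) * r ^ (m + i) * p ^ i * \<psi>'
        = r ^ (m + i) * (p ^ i * (real n * p + real (Suc i) * (\<psi>' - p)))"
      unfolding n(2) by (simp only: power_Suc) algebra
    then show ?thesis
      unfolding 1 2 n(1) 3[symmetric] by (simp only: mult_ac)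
  qed
  ultimately show ?thesis by (simp add: m i p_def)
qed

lemma power_diff_ge:
  fixes a b :: real
  assumes "0 \<le> a" "a \<le> b" "n \<ge> 1"
  shows "b ^ (n - 1) * (b - a) \<le> b ^ n - a ^ n"
proof -
  obtain m where m: "n = Suc m" using assms(3) by (cases n) auto
  have "a ^ m * a \<le> b ^ m * a" using assms by (intro mult_right_mono power_mono) auto
  then show ?thesis by (simp add: m algebra_simps)
qed

text \<open>
  A Keller--Osserman argument.  Integration of the divergence form of \<open>\<sigma>\<^sub>1 > 0\<close> shows that \<open>\<phi>\<close> is
  increasing; this sign is not visible from \<open>\<sigma>\<^sub>k\<close> alone when \<open>k\<close> is even.  Integration of
  \<open>\<sigma>\<^sub>k \<ge> K \<phi>\<^bsup>\<beta>\<^esup>\<close> over \<open>[a, b]\<close>, with \<open>\<phi> \<ge> \<phi>(a)\<close> there, bounds \<open>\<phi>'(b)\<^sup>k\<close> below by a multiple of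
  \<open>\<phi>(a)\<^bsup>\<beta>\<^esup> (b - a)\<close>, and a further integration gives the growth that excludes a global \<open>\<phi>\<close>.
\<close>
lemma no_entire_k_convex_radial_supersolution:
  fixes \<phi> :: "real \<Rightarrow> real" and K \<beta> :: real
  defines "V \<equiv> (\<lambda>x::real^'n. \<phi> (norm x))"
  assumes k: "1 \<le> k" "k \<le> CARD('n::finite)"
    and conv: "k_convex k V" and pos: "\<And>x. V x > 0"
    and super: "\<And>x. elem_sym k (eigenvalues (hessian V x)) \<ge> K * V x powr \<beta>"
    and "K > 0" "\<beta> > real k"
  shows False
proof -
  obtain i :: 'n where True by simp
  define e :: "real^'n" where "e = axis i 1"
  have e: "norm e = 1" "e \<noteq> 0" by (auto simp: e_def)
  let ?n = "CARD('n)"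
  define \<sigma> where "\<sigma> j r = elem_sym j (eigenvalues (hessian V (r *\<^sub>R e)))" for j r
  have "C2 V" using conv by (simp add: k_convex_def)
  then obtain \<psi> \<psi>' where
    phi: "\<And>r. r > 0 \<Longrightarrow> (\<phi> has_real_derivative \<psi> r) (at r)" and
    psi: "\<And>r. (\<psi> has_real_derivative \<psi>' r) (at r)" and psi0: "\<psi> 0 = 0" and
    hess: "\<And>r. r > 0 \<Longrightarrow> hessian V (r *\<^sub>R e)
        = mat (\<psi> r / r) + (\<psi>' r - \<psi> r / r) *\<^sub>R outer (sgn (r *\<^sub>R e))"
    unfolding V_def e_def by (rule radial_C2_profile[where i = i]) blast
  have \<sigma>_pos: "\<sigma> j r > 0" if "1 \<le> j" "j \<le> k" for j r
    using conv that by (auto simp: k_convex_def \<sigma>_def)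
  have \<sigma>_super: "\<sigma> k r \<ge> K * \<phi> r powr \<beta>" if "r \<ge> 0" for r
    using super[of "r *\<^sub>R e"] that e by (simp add: \<sigma>_def V_def)
  have \<phi>_pos: "\<phi> r > 0" if "r \<ge> 0" for r
    using pos[of "r *\<^sub>R e"] that e by (simp add: V_def)
  define P where "P j r = r ^ (?n - j) * \<psi> r ^ j" for j r
  have P: "(P j has_real_derivative real ?n * r ^ (?n - 1) * (\<sigma> j r / real (?n choose j))) (at r)"
    if "r > 0" "1 \<le> j" "j \<le> k" for j r
  proof -
    have "\<sigma> j r / real (?n choose j) = (\<psi> r / r) ^ (j - 1) * (\<psi> r / r + real j / real ?n * (\<psi>' r - \<psi> r / r))"
      unfolding \<sigma>_def hess[OF that(1)]
      using that k e by (subst elem_sym_radial_hessian) (auto simp: binomial_eq_0_iff)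
    then show ?thesis
      using DERIV_radial_divergence[OF psi that(1,2), of ?n] that k unfolding P_def[abs_def] by simp
  qed
  have P_cont: "continuous_on A (P j)" for A j
    unfolding P_def[abs_def]
    by (intro continuous_intros DERIV_continuous_on[where D = \<psi>'] DERIV_subset[OF psi]) auto
  have P0: "P j 0 = 0" if "1 \<le> j" for j using that psi0 by (simp add: P_def)
  have P_pos: "P j r > 0" if "r > 0" "1 \<le> j" "j \<le> k" for j r
  proof -
    have "P j 0 < P j r"
    proof (rule DERIV_pos_imp_increasing_open[OF that(1) _ P_cont])
      fix x :: real
      assume x: "0 < x"
      have "real ?n * x ^ (?n - 1) * (\<sigma> j x / real (?n choose j)) > 0"
        using x that k \<sigma>_pos[OF that(2,3), of x] by simp
      with P[OF x that(2,3)] show "\<exists>y. (P j has_real_derivative y) (at x) \<and> 0 < y" by blast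
    qed
    then show ?thesis using P0 that by simp
  qed
  have psi_pos: "\<psi> r > 0" if "r > 0" for r
    using P_pos[OF that, of 1] k that by (simp add: P_def zero_less_mult_iff)
  have \<phi>_cont: "continuous_on {a..b} \<phi>" if "a > 0" for a b
    using that by (intro DERIV_continuous_on[where D = \<psi>] DERIV_subset[OF phi]) auto
  have \<phi>_mono: "\<phi> a \<le> \<phi> b" if "0 < a" "a \<le> b" for a b
    using that phi psi_pos by (intro DERIV_nonneg_imp_nondecreasing[OF that(2)]) (meson less_imp_le order_less_le_trans)
  define \<kappa> where "\<kappa> = K / real (?n choose k)"
  have \<kappa>: "\<kappa> > 0" using \<open>K > 0\<close> k by (simp add: \<kappa>_def)
  have slope: "\<kappa> * \<phi> a powr \<beta> * (b - a) \<le> \<psi> b ^ k" if ab: "1 \<le> a" "a \<le> b" for a b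
  proof -
    define L where "L = \<kappa> * \<phi> a powr \<beta>"
    have L: "L \<ge> 0" using \<kappa> by (simp add: L_def)
    have "P k a - L * a ^ ?n \<le> P k b - L * b ^ ?n"
    proof (rule DERIV_nonneg_imp_nondecreasing[OF ab(2)], intro exI conjI)
      fix r assume r: "a \<le> r" "r \<le> b"
      then have "r > 0" using ab by simp
      then show "((\<lambda>r. P k r - L * r ^ ?n) has_real_derivative
          real ?n * r ^ (?n - 1) * (\<sigma> k r / real (?n choose k)) - L * (real ?n * r ^ (?n - 1))) (at r)"
        using k by (auto intro!: derivative_eq_intros P)
      have "K * \<phi> a powr \<beta> \<le> K * \<phi> r powr \<beta>"
        using \<open>K > 0\<close> \<open>\<beta> > real k\<close> r ab \<phi>_mono[of a r] \<phi>_pos[of a] by (intro mult_left_mono powr_mono2) auto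
      also have "\<dots> \<le> \<sigma> k r" using \<sigma>_super \<open>r > 0\<close> by simp
      finally have "L \<le> \<sigma> k r / real (?n choose k)"
        unfolding L_def \<kappa>_def using k by (simp add: divide_right_mono)
      then have "real ?n * r ^ (?n - 1) * L \<le> real ?n * r ^ (?n - 1) * (\<sigma> k r / real (?n choose k))"
        using \<open>r > 0\<close> by (intro mult_left_mono) auto
      then show "0 \<le> real ?n * r ^ (?n - 1) * (\<sigma> k r / real (?n choose k)) - L * (real ?n * r ^ (?n - 1))"
        by (simp add: mult_ac)
    qed
    moreover have "P k a > 0" using P_pos[of a k] ab k by simp
    ultimately have "L * (b ^ ?n - a ^ ?n) \<le> P k b" by (simp add: algebra_simps)
    moreover have "L * (b ^ (?n - 1) * (b - a)) \<le> L * (b ^ ?n - a ^ ?n)"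
      using ab L by (intro mult_left_mono power_diff_ge) auto
    ultimately have "b ^ (?n - 1) * (L * (b - a)) \<le> b ^ (?n - k) * \<psi> b ^ k"
      by (simp add: P_def mult_ac)
    \<comment> \<open>This comparison of powers is where \<open>b \<ge> 1\<close> enters; it discards the factor \<open>b\<^bsup>k-1\<^esup>\<close>.\<close>
    moreover have "b ^ (?n - k) * (L * (b - a)) \<le> b ^ (?n - 1) * (L * (b - a))"
      using ab k L by (intro mult_right_mono power_increasing) auto
    ultimately have "b ^ (?n - k) * (L * (b - a)) \<le> b ^ (?n - k) * \<psi> b ^ k" by linarith
    then show ?thesis using ab by (simp add: L_def)
  qed
  show False
  proof (rule no_global_superlinear_growth)
    show "\<phi> a > 0" if "a \<ge> 1" for a using \<phi>_pos that by simp
    show "\<phi> a \<le> \<phi> b" if "1 \<le> a" "a \<le> b" for a b using \<phi>_mono that by simp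
    show "\<kappa> / 2 ^ Suc k > 0" using \<kappa> by simp
    show "\<beta> > real k" "k \<ge> 1" by fact+
    fix a h :: real
    assume a: "1 \<le> a" and h: "0 < h"
    \<comment> \<open>On the second half of the interval the slope bound is not degenerate, since \<open>z - a \<ge> h / 2\<close>.\<close>
    have "\<exists>z. a + h / 2 < z \<and> z < a + h \<and> \<phi> (a + h) - \<phi> (a + h / 2) = (a + h - (a + h / 2)) * \<psi> z"
      using a h by (intro MVT2 phi) auto
    then obtain z where z: "a + h / 2 < z" "z < a + h" "\<phi> (a + h) - \<phi> (a + h / 2) = h / 2 * \<psi> z"
      by (auto simp: field_simps)
    have "\<kappa> * \<phi> a powr \<beta> * (h / 2) \<le> \<kappa> * \<phi> a powr \<beta> * (z - a)"
      using \<kappa> z by (intro mult_left_mono) auto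
    also have "\<dots> \<le> \<psi> z ^ k" using slope[of a z] a h z by simp
    finally have "\<kappa> * \<phi> a powr \<beta> * (h / 2) * (h / 2) ^ k \<le> \<psi> z ^ k * (h / 2) ^ k"
      using h by (intro mult_right_mono) auto
    also have "\<dots> = (\<phi> (a + h) - \<phi> (a + h / 2)) ^ k"
      unfolding z(3) power_mult_distrib by (rule mult.commute)
    also have "\<dots> \<le> (\<phi> (a + h) - \<phi> a) ^ k"
      using \<phi>_mono[of a "a + h / 2"] \<phi>_mono[of "a + h / 2" "a + h"] a h by (intro power_mono) auto
    finally show "\<kappa> / 2 ^ Suc k * \<phi> a powr \<beta> * h ^ Suc k \<le> (\<phi> (a + h) - \<phi> a) ^ k"
      by (simp add: power_divide mult_ac)
  qed
qed

section \<open>A global Volterra fixed point\<close>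

lemma continuous_on_atLeast0I:
  fixes f :: "real \<Rightarrow> real"
  assumes "\<And>R. R > 0 \<Longrightarrow> continuous_on {0..R} f"
  shows "continuous_on {0..} f"
  unfolding continuous_on_eq_continuous_within
proof
  fix x :: real
  assume x: "x \<in> {0..}"
  have "continuous (at x within {0..x + 1}) f"
    using assms[of "x + 1"] x by (simp add: continuous_on_eq_continuous_within)
  moreover have "at x within {0..x + 1} = at x within {0..}"
    by (rule at_within_nhd[of _ "{..<x + 1}"]) auto
  ultimately show "continuous (at x within {0..}) f" by simp
qed

lemma integral_power_bound:
  fixes f :: "real \<Rightarrow> real"
  assumes "continuous_on {0..s} f" "s \<ge> 0" "\<And>x. x \<in> {0..s} \<Longrightarrow> \<bar>f x\<bar> \<le> D * x ^ m"
  shows "\<bar>integral {0..s} f\<bar> \<le> D * s ^ Suc m / real (Suc m)"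
proof -
  have I: "((\<lambda>x. D * x ^ m) has_integral D * s ^ Suc m / real (Suc m) - D * 0 ^ Suc m / real (Suc m)) {0..s}"
    using assms(2)
    by (intro fundamental_theorem_of_calculus)
       (auto simp flip: has_real_derivative_iff_has_vector_derivative simp del: of_nat_Suc power_Suc
         intro!: derivative_eq_intros)
  have "norm (integral {0..s} f) \<le> integral {0..s} (\<lambda>x. D * x ^ m)"
    using assms I by (intro integral_norm_bound_integral integrable_continuous_real continuous_intros) auto
  then show ?thesis using integral_unique[OF I] by simp
qed

text \<open>
  Picard iteration for \<open>u' = N(u)\<close>, \<open>u(0) = a\<close>, on all of \<open>[0, \<infinity>)\<close>.  At \<open>s\<close>, the operator
  \<open>N\<close> may depend on the values of \<open>u\<close> on all of \<open>[0, s]\<close>.  The Lipschitz condition transports bounds of the form \<open>C s\<^sup>m\<close>, so that consecutive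
  iterates differ by at most \<open>K (L s)\<^sup>m / m!\<close> on \<open>[0, R]\<close>.  This is summable for every \<open>L\<close> and \<open>R\<close>:
  convergence is locally uniform and no interval has to be shrunk.
\<close>
lemma volterra_fixed_point:
  fixes N :: "(real \<Rightarrow> real) \<Rightarrow> real \<Rightarrow> real" and a :: real and B :: "real \<Rightarrow> real"
  defines "X \<equiv> {u. continuous_on {0..} u \<and> (\<forall>s\<ge>0. a \<le> u s \<and> u s \<le> B s)}"
  assumes B: "\<And>s. s \<ge> 0 \<Longrightarrow> a \<le> B s"
    and N_cont: "\<And>u. u \<in> X \<Longrightarrow> continuous_on {0..} (N u)"
    and self: "\<And>u. u \<in> X \<Longrightarrow> (\<lambda>s. a + integral {0..s} (N u)) \<in> X"
    and lip: "\<And>R. R > 0 \<Longrightarrow> \<exists>L\<ge>0. \<forall>u\<in>X. \<forall>v\<in>X. \<forall>C\<ge>0. \<forall>m.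
       (\<forall>s\<in>{0..R}. \<bar>u s - v s\<bar> \<le> C * s ^ m) \<longrightarrow> (\<forall>s\<in>{0..R}. \<bar>N u s - N v s\<bar> \<le> L * C * s ^ m)"
  obtains u where "u \<in> X" "\<And>s. s \<ge> 0 \<Longrightarrow> u s = a + integral {0..s} (N u)"
proof -
  define T where "T u = (\<lambda>s. a + integral {0..s} (N u))" for u
  define u where "u m = (T ^^ m) (\<lambda>_. a)" for m
  have u_Suc: "u (Suc m) = T (u m)" for m by (simp add: u_def)
  have uX: "u m \<in> X" for m
  proof (induction m)
    case 0
    then show ?case using B by (auto simp: u_def X_def)
  next
    case (Suc m)
    then show ?case using self by (simp add: u_Suc T_def)
  qed
  have T_diff: "\<bar>T v s - T w s\<bar> \<le> D * s ^ Suc m / real (Suc m)"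
    if "v \<in> X" "w \<in> X" "0 \<le> s" "\<And>x. x \<in> {0..s} \<Longrightarrow> \<bar>N v x - N w x\<bar> \<le> D * x ^ m" for v w s D m
  proof -
    have c: "continuous_on {0..s} (N v)" "continuous_on {0..s} (N w)"
      by (auto intro!: continuous_on_subset[OF N_cont] that)
    have "T v s - T w s = integral {0..s} (\<lambda>x. N v x - N w x)"
      using c by (simp add: T_def integral_diff integrable_continuous_real)
    then show ?thesis
      using integral_power_bound[of s "\<lambda>x. N v x - N w x" D m] c that by (simp add: continuous_on_diff)
  qed
  define U where "U s = a + (\<Sum>i. u (Suc i) s - u i s)" for s
  have unif: "uniform_limit {0..R} u U sequentially" if R: "R > 0" for R
  proof -
    obtain L where L: "L \<ge> 0" "\<And>v w C m s. v \<in> X \<Longrightarrow> w \<in> X \<Longrightarrow> C \<ge> 0 \<Longrightarrow>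
       (\<And>s. s\<in>{0..R} \<Longrightarrow> \<bar>v s - w s\<bar> \<le> C * s ^ m) \<Longrightarrow> s \<in> {0..R} \<Longrightarrow> \<bar>N v s - N w s\<bar> \<le> L * C * s ^ m"
      using lip[OF R] by metis
    have "continuous_on {0..R} (\<lambda>s. u 1 s - u 0 s)"
      using uX[of 0] uX[of 1] by (intro continuous_on_diff) (auto simp: X_def intro: continuous_on_subset)
    then have "bounded ((\<lambda>s. u 1 s - u 0 s) ` {0..R})"
      by (intro compact_imp_bounded compact_continuous_image) auto
    then obtain K where K: "\<And>s. s \<in> {0..R} \<Longrightarrow> \<bar>u 1 s - u 0 s\<bar> \<le> K"
      unfolding bounded_iff by (metis image_eqI real_norm_def)
    have K0: "K \<ge> 0" using K[of 0] R by auto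
    have est: "\<bar>u (Suc m) s - u m s\<bar> \<le> K * L ^ m / fact m * s ^ m" if "s \<in> {0..R}" for m s
      using that
    proof (induction m arbitrary: s)
      case 0
      then show ?case using K by simp
    next
      case (Suc m)
      have "\<bar>N (u (Suc m)) x - N (u m) x\<bar> \<le> L * (K * L ^ m / fact m) * x ^ m" if "x \<in> {0..s}" for x
        using that Suc.prems L(1) K0 by (intro L(2) uX Suc.IH) auto
      from T_diff[OF uX uX _ this] Suc.prems
      have "\<bar>u (Suc (Suc m)) s - u (Suc m) s\<bar> \<le> L * (K * L ^ m / fact m) * s ^ Suc m / real (Suc m)"
        by (simp only: u_Suc) auto
      then show ?case by (simp add: field_simps)
    qed
    have "uniform_limit {0..R} (\<lambda>n s. \<Sum>i<n. u (Suc i) s - u i s) (\<lambda>s. \<Sum>i. u (Suc i) s - u i s) sequentially"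
    proof (rule Weierstrass_m_test)
      fix m s assume s: "s \<in> {0..R}"
      have "K * L ^ m / fact m * s ^ m \<le> K * L ^ m / fact m * R ^ m"
        using s K0 L(1) by (intro mult_left_mono power_mono) auto
      then show "norm (u (Suc m) s - u m s) \<le> K * (inverse (fact m) * (L * R) ^ m)"
        using est[OF s, of m] by (simp add: field_simps)
    qed (intro summable_mult summable_exp)
    moreover have "(\<Sum>i<n. u (Suc i) s - u i s) = u n s - a" for n s
      using sum_lessThan_telescope[of "\<lambda>i. u i s" n] by (simp add: u_def)
    ultimately show ?thesis
      by (simp add: U_def[abs_def] uniform_limit_iff dist_real_def algebra_simps)
  qed
  have lim: "(\<lambda>n. u n s) \<longlonglongrightarrow> U s" if "s \<ge> 0" for s
    using tendsto_uniform_limitI[OF unif[of "s + 1"]] that by auto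
  have u_cont: "continuous_on {0..R} (u m)" for R m
    by (rule continuous_on_subset[of "{0..}"]) (use uX in \<open>auto simp: X_def\<close>)
  have "continuous_on {0..R} U" if "R > 0" for R
    by (intro uniform_limit_theorem[OF _ unif[OF that]] always_eventually allI u_cont) auto
  then have "continuous_on {0..} U" by (rule continuous_on_atLeast0I)
  moreover have "a \<le> U s" "U s \<le> B s" if "s \<ge> 0" for s
    using uX that by (auto intro!: LIMSEQ_le_const[OF lim] LIMSEQ_le_const2[OF lim] simp: X_def)
  ultimately have UX: "U \<in> X" by (simp add: X_def)
  have "U s = T U s" if s: "s \<ge> 0" for s
  proof -
    define R where "R = s + 1"
    have R: "R > 0" "s \<in> {0..R}" using s by (auto simp: R_def)
    obtain L where L: "L \<ge> 0" "\<And>v w C m s. v \<in> X \<Longrightarrow> w \<in> X \<Longrightarrow> C \<ge> 0 \<Longrightarrow>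
       (\<And>s. s\<in>{0..R} \<Longrightarrow> \<bar>v s - w s\<bar> \<le> C * s ^ m) \<Longrightarrow> s \<in> {0..R} \<Longrightarrow> \<bar>N v s - N w s\<bar> \<le> L * C * s ^ m"
      using lip[OF R(1)] by metis
    have "(\<lambda>n. u (Suc n) s) \<longlonglongrightarrow> T U s"
    proof (rule LIMSEQ_I)
      fix \<epsilon> :: real assume \<epsilon>: "\<epsilon> > 0"
      define \<delta> where "\<delta> = \<epsilon> / (2 * (L * R + 1))"
      have LR: "L * R \<ge> 0" using L R by simp
      then have \<delta>: "\<delta> > 0" using \<epsilon> by (simp add: \<delta>_def)
      obtain n0 where n0: "\<And>n x. n \<ge> n0 \<Longrightarrow> x \<in> {0..R} \<Longrightarrow> \<bar>u n x - U x\<bar> < \<delta>"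
        using uniform_limitD[OF unif[OF R(1)] \<delta>]
        unfolding eventually_sequentially dist_real_def by blast
      have "norm (u (Suc n) s - T U s) < \<epsilon>" if n: "n \<ge> n0" for n
      proof -
        have "\<bar>N (u n) x - N U x\<bar> \<le> L * \<delta> * x ^ 0" if "x \<in> {0..s}" for x
          using n0[OF n] that \<delta> R by (intro L(2) uX UX) (auto simp: less_imp_le)
        from T_diff[OF uX UX s this] have "\<bar>u (Suc n) s - T U s\<bar> \<le> L * \<delta> * s"
          by (simp add: u_Suc)
        also have "\<dots> \<le> L * \<delta> * R" using R \<delta> L by (intro mult_left_mono) auto
        also have "\<dots> = \<epsilon> * (L * R / (2 * (L * R + 1)))" by (simp add: \<delta>_def)
        also have "\<dots> < \<epsilon> * 1" using LR \<epsilon> by (intro mult_strict_left_mono) (auto simp: divide_less_eq)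
        finally show ?thesis by simp
      qed
      then show "\<exists>n0. \<forall>n\<ge>n0. norm (u (Suc n) s - T U s) < \<epsilon>" by blast
    qed
    then show ?thesis using LIMSEQ_Suc[OF lim[OF s]] LIMSEQ_unique by blast
  qed
  with UX show thesis by (intro that) (auto simp: T_def)
qed

section \<open>Existence of the radial profile\<close>

lemma powr_lipschitz:
  fixes q \<delta> x y :: real
  assumes "q \<le> 1" "\<delta> > 0" "x \<ge> \<delta>" "y \<ge> \<delta>"
  shows "\<bar>x powr q - y powr q\<bar> \<le> \<bar>q\<bar> * \<delta> powr (q - 1) * \<bar>x - y\<bar>"
proof -
  have "norm (x powr q - y powr q) \<le> \<bar>q\<bar> * \<delta> powr (q - 1) * norm (x - y)"
  proof (rule field_differentiable_bound[where S = "{\<delta>..}" and f = "\<lambda>z. z powr q" and f' = "\<lambda>z. q * z powr (q - 1)"])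
    fix z assume z: "z \<in> {\<delta>..}"
    then show "((\<lambda>z. z powr q) has_field_derivative q * z powr (q - 1)) (at z within {\<delta>..})"
      using assms by (intro has_field_derivative_at_within[OF has_real_derivative_powr]) auto
    have "z powr (q - 1) \<le> \<delta> powr (q - 1)" using z assms by (intro powr_mono2') auto
    then show "norm (q * z powr (q - 1)) \<le> \<bar>q\<bar> * \<delta> powr (q - 1)"
      by (simp add: abs_mult mult_left_mono)
  qed (use assms in auto)
  then show ?thesis by simp
qed

text \<open>
  For \<open>r > 0\<close> this is the mean value \<open>n r\<^bsup>-n\<^esup> \<integral>\<^sub>0\<^sup>r \<tau>\<^bsup>n-1\<^esup> \<Phi>(\<tau>) d\<tau>\<close> of the radial function
  \<open>\<Phi>(|x|)\<close> over the ball of radius \<open>r\<close>.  Integrating over the fixed interval \<open>[0, 1]\<close> removes the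
  singularity at \<open>r = 0\<close>.
\<close>
definition radial_mean :: "nat \<Rightarrow> (real \<Rightarrow> real) \<Rightarrow> real \<Rightarrow> real" where
  "radial_mean n \<Phi> r = real n * integral {0..1} (\<lambda>\<theta>. \<theta> ^ (n - 1) * \<Phi> (r * \<theta>))"

lemma radial_mean_weight:
  assumes "n \<ge> 1"
  shows "((\<lambda>\<theta>. real n * \<theta> ^ (n - 1)) has_integral 1) {0..1::real}"
proof -
  have "((\<lambda>\<theta>. real n * \<theta> ^ (n - 1)) has_integral 1 ^ n - 0 ^ n) {0..1::real}"
    by (intro fundamental_theorem_of_calculus)
       (auto simp flip: has_real_derivative_iff_has_vector_derivative intro!: derivative_eq_intros)
  then show ?thesis using assms by (simp add: power_0_left)
qed

lemma radial_mean_integrable: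
  fixes \<Phi> :: "real \<Rightarrow> real"
  assumes "continuous_on {0..} \<Phi>" "r \<ge> 0"
  shows "(\<lambda>\<theta>. \<theta> ^ (n - 1) * \<Phi> (r * \<theta>)) integrable_on {0..1}"
  using assms(2)
  by (intro integrable_continuous_real continuous_intros continuous_on_compose2[OF assms(1)]) auto

lemma radial_mean_const: "n \<ge> 1 \<Longrightarrow> radial_mean n (\<lambda>_. c) r = c"
  using integral_unique[OF radial_mean_weight, of n] by (simp add: radial_mean_def)

lemma radial_mean_0: "n \<ge> 1 \<Longrightarrow> radial_mean n \<Phi> 0 = \<Phi> 0"
  using radial_mean_const[of n "\<Phi> 0" 0] by (simp add: radial_mean_def)

lemma radial_mean_mono:
  assumes "continuous_on {0..} \<Phi>" "continuous_on {0..} \<Psi>" "r \<ge> 0"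
    and "\<And>\<tau>. 0 \<le> \<tau> \<Longrightarrow> \<tau> \<le> r \<Longrightarrow> \<Phi> \<tau> \<le> \<Psi> \<tau>"
  shows "radial_mean n \<Phi> r \<le> radial_mean n \<Psi> r"
  unfolding radial_mean_def
  using assms mult_left_mono[of _ 1 r]
  by (intro mult_left_mono integral_le radial_mean_integrable) auto

lemma radial_mean_diff:
  assumes "continuous_on {0..} \<Phi>" "continuous_on {0..} \<Psi>" "r \<ge> 0"
  shows "radial_mean n (\<lambda>\<tau>. \<Phi> \<tau> - \<Psi> \<tau>) r = radial_mean n \<Phi> r - radial_mean n \<Psi> r"
  using integral_diff[OF radial_mean_integrable[OF assms(1,3), of n] radial_mean_integrable[OF assms(2,3), of n]]
  by (simp add: radial_mean_def right_diff_distrib)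

lemma radial_mean_abs_le:
  assumes "continuous_on {0..} \<Phi>" "r \<ge> 0" "n \<ge> 1"
    and "\<And>\<tau>. 0 \<le> \<tau> \<Longrightarrow> \<tau> \<le> r \<Longrightarrow> \<bar>\<Phi> \<tau>\<bar> \<le> D"
  shows "\<bar>radial_mean n \<Phi> r\<bar> \<le> D"
proof -
  have "radial_mean n \<Phi> r \<le> radial_mean n (\<lambda>_. D) r" "radial_mean n (\<lambda>_. - D) r \<le> radial_mean n \<Phi> r"
    using assms by (intro radial_mean_mono continuous_on_const; force)+
  then show ?thesis using assms(3) by (simp add: radial_mean_const)
qed

lemma continuous_on_radial_mean:
  assumes "continuous_on {0..} \<Phi>"
  shows "continuous_on {0..} (radial_mean n \<Phi>)"
proof -
  have "continuous_on ({0..} \<times> cbox 0 1) (\<lambda>(r, \<theta>). \<theta> ^ (n - 1) * \<Phi> (r * \<theta> :: real))"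
    unfolding case_prod_unfold
    by (intro continuous_intros continuous_on_compose2[OF assms]) auto
  from integral_continuous_on_param[OF this] show ?thesis
    unfolding radial_mean_def[abs_def] by (intro continuous_intros) simp
qed

lemma radial_mean_eq:
  assumes "continuous_on {0..} \<Phi>" "r > 0" "n \<ge> 1"
  shows "radial_mean n \<Phi> r = real n * integral {0..r} (\<lambda>\<tau>. \<tau> ^ (n - 1) * \<Phi> \<tau>) / r ^ n"
proof -
  let ?I = "integral {0..r} (\<lambda>\<tau>. \<tau> ^ (n - 1) * \<Phi> \<tau>)"
  obtain m where m: "n = Suc m" using assms(3) by (cases n) auto
  have "((\<lambda>\<tau>. \<tau> ^ (n - 1) * \<Phi> \<tau>) has_integral ?I) {0..r}"
    by (intro integrable_integral integrable_continuous_real continuous_intros continuous_on_subset[OF assms(1)]) auto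
  from has_integral_stretch_real[OF this, of r]
  have "((\<lambda>\<theta>. (r * \<theta>) ^ (n - 1) * \<Phi> (r * \<theta>)) has_integral ?I / r) {0..1}"
    using assms(2) by simp
  from has_integral_mult_right[OF this, of "1 / r ^ (n - 1)"]
  have "((\<lambda>\<theta>. \<theta> ^ (n - 1) * \<Phi> (r * \<theta>)) has_integral ?I / r ^ n) {0..1}"
    using assms(2) by (simp add: m power_mult_distrib mult_ac)
  from integral_unique[OF this] show ?thesis by (simp add: radial_mean_def)
qed

text \<open>
  The product of \<open>r\<^sup>n\<close> and the mean is \<open>n \<integral>\<^sub>0\<^sup>r \<tau>\<^bsup>n-1\<^esup> \<Phi>(\<tau>) d\<tau>\<close>, with derivative
  \<open>n r\<^bsup>n-1\<^esup> \<Phi>(r)\<close>; the product rule does the rest.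
\<close>
lemma DERIV_radial_mean:
  assumes "continuous_on {0..} \<Phi>" "r > 0" "n \<ge> 1"
  shows "(radial_mean n \<Phi> has_real_derivative real n * (\<Phi> r - radial_mean n \<Phi> r) / r) (at r)"
proof -
  let ?J = "\<lambda>r. integral {0..r} (\<lambda>\<tau>. \<tau> ^ (n - 1) * \<Phi> \<tau>)"
  obtain m where m: "n = Suc m" using assms(3) by (cases n) auto
  have "(?J has_real_derivative r ^ (n - 1) * \<Phi> r) (at r within {0..r + 1})"
    using assms(2)
    by (intro integral_has_real_derivative continuous_on_mult continuous_on_power continuous_on_id
        continuous_on_subset[OF assms(1)]) auto
  then have J: "(?J has_real_derivative r ^ (n - 1) * \<Phi> r) (at r)"
    using assms(2) by (simp add: at_within_Icc_at)
  have "((\<lambda>r. real n * ?J r / r ^ n) has_real_derivative real n * (\<Phi> r - radial_mean n \<Phi> r) / r) (at r)"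
  proof -
    have "((\<lambda>r. real n * ?J r / r ^ n) has_real_derivative
        ((real n * (r ^ (n - 1) * \<Phi> r)) * r ^ n - (real n * ?J r) * (real n * r ^ (n - 1))) / (r ^ n * r ^ n)) (at r)"
      using DERIV_divide[OF DERIV_cmult[OF J, of "real n"] DERIV_pow[of n r]] assms(2) by simp
    moreover have "((real n * (r ^ (n - 1) * \<Phi> r)) * r ^ n - (real n * ?J r) * (real n * r ^ (n - 1))) / (r ^ n * r ^ n)
        = real n * (\<Phi> r - radial_mean n \<Phi> r) / r"
      unfolding radial_mean_eq[OF assms] using assms(2) by (simp add: m field_simps)
    ultimately show ?thesis by simp
  qed
  then show ?thesis
    by (rule has_field_derivative_transform_within_open[of _ _ _ "{0<..}"])
      (use assms radial_mean_eq in auto)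
qed

text \<open>
  The two powers involved are Lipschitz on the ranges that occur: \<open>y\<^bsup>-\<gamma>\<^esup>\<close> because \<open>u, v \<ge> 1\<close>, and the
  \<open>k\<close>-th root, which is not Lipschitz near \<open>0\<close>, because \<open>\<delta>\<close> bounds its argument from below.  A bound
  \<open>C s\<^sup>m\<close> survives averaging since \<open>\<tau>\<^sup>2 \<le> s\<close> for \<open>\<tau> \<le> sqrt s\<close>.
\<close>
lemma mean_kernel_lipschitz:
  fixes h u v :: "real \<Rightarrow> real" and c k C M R b \<gamma> :: real
  assumes "n \<ge> 1" "k \<ge> 1" "c > 0" "\<gamma> > 0" "R > 0" "C \<ge> 0" "m0 > 0"
    and h: "continuous_on {0..} h" "\<And>r. r \<ge> 0 \<Longrightarrow> h r \<le> M" "\<And>r. 0 \<le> r \<Longrightarrow> r \<le> sqrt R \<Longrightarrow> m0 \<le> h r"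
    and u: "continuous_on {0..} u" "\<And>s. s \<ge> 0 \<Longrightarrow> 1 \<le> u s" "\<And>s. 0 \<le> s \<Longrightarrow> s \<le> R \<Longrightarrow> u s \<le> b"
    and v: "continuous_on {0..} v" "\<And>s. s \<ge> 0 \<Longrightarrow> 1 \<le> v s" "\<And>s. 0 \<le> s \<Longrightarrow> s \<le> R \<Longrightarrow> v s \<le> b"
    and diff: "\<And>s. 0 \<le> s \<Longrightarrow> s \<le> R \<Longrightarrow> \<bar>u s - v s\<bar> \<le> C * s ^ m"
    and s: "0 \<le> s" "s \<le> R"
  defines "N \<equiv> \<lambda>u s. (c * radial_mean n (\<lambda>\<tau>. h \<tau> * u (\<tau>\<^sup>2) powr (- \<gamma>)) (sqrt s)) powr (1 / k)"
  defines "\<delta> \<equiv> c * (m0 * b powr (- \<gamma>))"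
  shows "\<bar>N u s - N v s\<bar> \<le> (1 / k) * \<delta> powr (1 / k - 1) * c * M * \<gamma> * C * s ^ m"
proof -
  define \<Phi> where "\<Phi> u \<tau> = h \<tau> * u (\<tau>\<^sup>2) powr (- \<gamma>)" for u :: "real \<Rightarrow> real" and \<tau>
  let ?r = "sqrt s"
  have r: "?r \<ge> 0" "?r \<le> sqrt R" using s by auto
  have "0 < h 0" using h(3)[of 0] \<open>m0 > 0\<close> \<open>R > 0\<close> by simp
  then have M: "M \<ge> 0" using h(2)[of 0] by linarith
  have b: "b \<ge> 1" using u(2,3)[of 0] \<open>R > 0\<close> by fastforce
  have cont: "continuous_on {0..} (\<Phi> w)" if "continuous_on {0..} w" "\<And>s. s \<ge> 0 \<Longrightarrow> 1 \<le> w s" for w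
  proof -
    have "continuous_on {0..} (\<lambda>\<tau>. w (\<tau>\<^sup>2))"
      by (rule continuous_on_compose2[OF that(1)]) (auto intro!: continuous_on_power continuous_on_id)
    moreover have "w (\<tau>\<^sup>2) \<noteq> 0" for \<tau> using that(2)[of "\<tau>\<^sup>2"] by auto
    ultimately show ?thesis unfolding \<Phi>_def[abs_def]
      by (intro continuous_on_mult h(1) continuous_on_powr continuous_on_const) auto
  qed
  have sq: "0 \<le> \<tau>\<^sup>2 \<and> \<tau>\<^sup>2 \<le> s \<and> \<tau>\<^sup>2 \<le> R" if "0 \<le> \<tau>" "\<tau> \<le> ?r" for \<tau>
  proof -
    have "\<tau>\<^sup>2 \<le> ?r\<^sup>2" using that by (intro power_mono)
    then show ?thesis using s by simp
  qed
  have low: "\<delta> \<le> c * radial_mean n (\<Phi> w) ?r"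
    if w: "continuous_on {0..} w" "\<And>s. s \<ge> 0 \<Longrightarrow> 1 \<le> w s" "\<And>s. 0 \<le> s \<Longrightarrow> s \<le> R \<Longrightarrow> w s \<le> b" for w
  proof -
    have "radial_mean n (\<lambda>_. m0 * b powr (- \<gamma>)) ?r \<le> radial_mean n (\<Phi> w) ?r"
    proof (intro radial_mean_mono continuous_on_const cont w r)
      fix \<tau> assume t: "0 \<le> \<tau>" "\<tau> \<le> ?r"
      have "b powr (- \<gamma>) \<le> w (\<tau>\<^sup>2) powr (- \<gamma>)"
        using sq[OF t] w(2)[of "\<tau>\<^sup>2"] w(3)[of "\<tau>\<^sup>2"] \<open>\<gamma> > 0\<close> by (intro powr_mono2') auto
      then show "m0 * b powr (- \<gamma>) \<le> \<Phi> w \<tau>"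
        unfolding \<Phi>_def using h(3)[of \<tau>] t r \<open>m0 > 0\<close> by (intro mult_mono) auto
    qed
    then show ?thesis using assms(1,3) by (simp add: radial_mean_const \<delta>_def)
  qed
  have "\<bar>radial_mean n (\<lambda>\<tau>. \<Phi> u \<tau> - \<Phi> v \<tau>) ?r\<bar> \<le> M * (\<gamma> * (C * s ^ m))"
  proof (rule radial_mean_abs_le)
    show "continuous_on {0..} (\<lambda>\<tau>. \<Phi> u \<tau> - \<Phi> v \<tau>)"
      using cont u v by (intro continuous_on_diff) auto
    fix \<tau> assume t: "0 \<le> \<tau>" "\<tau> \<le> ?r"
    have "\<bar>u (\<tau>\<^sup>2) powr (- \<gamma>) - v (\<tau>\<^sup>2) powr (- \<gamma>)\<bar> \<le> \<gamma> * \<bar>u (\<tau>\<^sup>2) - v (\<tau>\<^sup>2)\<bar>"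
      using powr_lipschitz[of "- \<gamma>" 1 "u (\<tau>\<^sup>2)" "v (\<tau>\<^sup>2)"] u(2) v(2) \<open>\<gamma> > 0\<close> by simp
    also have "\<bar>u (\<tau>\<^sup>2) - v (\<tau>\<^sup>2)\<bar> \<le> C * (\<tau>\<^sup>2) ^ m" using diff sq[OF t] by simp
    also have "C * (\<tau>\<^sup>2) ^ m \<le> C * s ^ m"
      using sq[OF t] \<open>C \<ge> 0\<close> by (intro mult_left_mono power_mono) auto
    finally have "\<bar>u (\<tau>\<^sup>2) powr (- \<gamma>) - v (\<tau>\<^sup>2) powr (- \<gamma>)\<bar> \<le> \<gamma> * (C * s ^ m)"
      using \<open>\<gamma> > 0\<close> by simp
    moreover have "0 \<le> h \<tau>" "h \<tau> \<le> M" using h(2)[of \<tau>] h(3)[of \<tau>] t r \<open>m0 > 0\<close> by auto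
    ultimately have "h \<tau> * \<bar>u (\<tau>\<^sup>2) powr (- \<gamma>) - v (\<tau>\<^sup>2) powr (- \<gamma>)\<bar> \<le> M * (\<gamma> * (C * s ^ m))"
      using M by (intro mult_mono) auto
    then show "\<bar>\<Phi> u \<tau> - \<Phi> v \<tau>\<bar> \<le> M * (\<gamma> * (C * s ^ m))"
      using \<open>0 \<le> h \<tau>\<close> by (simp add: \<Phi>_def abs_mult flip: right_diff_distrib)
  qed (use assms r in auto)
  then have mean: "\<bar>radial_mean n (\<Phi> u) ?r - radial_mean n (\<Phi> v) ?r\<bar> \<le> M * (\<gamma> * (C * s ^ m))"
    using cont u v r by (simp add: radial_mean_diff)
  have \<delta>: "\<delta> > 0" using assms(3) \<open>m0 > 0\<close> b by (simp add: \<delta>_def)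
  have "\<bar>N u s - N v s\<bar> \<le> (1 / k) * \<delta> powr (1 / k - 1)
      * \<bar>c * radial_mean n (\<Phi> u) ?r - c * radial_mean n (\<Phi> v) ?r\<bar>"
    using powr_lipschitz[OF _ \<delta> low[OF u] low[OF v], of "1 / k"] \<open>k \<ge> 1\<close>
    by (simp add: N_def \<Phi>_def[abs_def])
  also have "\<dots> \<le> (1 / k) * \<delta> powr (1 / k - 1) * (c * (M * (\<gamma> * (C * s ^ m))))"
    using mean \<open>c > 0\<close> \<open>k \<ge> 1\<close>
    by (intro mult_left_mono) (auto simp: abs_mult simp flip: right_diff_distrib)
  finally show ?thesis by (simp add: mult_ac)
qed

text \<open>
  By the divergence form of \<open>\<sigma>\<^sub>k\<close>, the equation
  \<open>p\<^bsup>k-1\<^esup> (p + (k/n) r p') = c \<Phi>\<close>, with \<open>\<Phi>(r) = h(r) G(r\<^sup>2)\<^bsup>-\<gamma>\<^esup>\<close>, says that \<open>p\<^sup>k\<close> is \<open>c\<close> times the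
  ball mean of \<open>\<Phi>\<close>.  Since \<open>2 G'(r\<^sup>2) = p(r)\<close>, this is a fixed-point equation for \<open>G\<close> in the variable
  \<open>s = r\<^sup>2\<close>.  The bounds \<open>1 \<le> G \<le> 1 + \<mu> s\<close> are preserved, as \<open>h\<close> is bounded and \<open>\<gamma> > 0\<close>; on \<open>[0, R]\<close>
  they keep \<open>\<Phi>\<close> away from \<open>0\<close>.
\<close>
lemma radial_profile_exists:
  fixes h :: "real \<Rightarrow> real" and c \<gamma> :: real and n k :: nat
  assumes "n \<ge> 1" "k \<ge> 1" "c > 0" "\<gamma> > 0"
    and h: "continuous_on {0..} h" "\<And>r. r \<ge> 0 \<Longrightarrow> 0 < h r" "\<And>r. r \<ge> 0 \<Longrightarrow> h r \<le> M"
  obtains G p q where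
    "\<And>s. s \<ge> 0 \<Longrightarrow> 1 \<le> G s"
    "\<And>s. s \<ge> 0 \<Longrightarrow> (G has_real_derivative p (sqrt s) / 2) (at s within {0..})"
    "continuous_on {0..} p" "\<And>r. r \<ge> 0 \<Longrightarrow> p r > 0"
    "\<And>r. r > 0 \<Longrightarrow> (p has_real_derivative q r / r) (at r)"
    "continuous_on {0..} q" "q 0 = 0"
    "\<And>r. r \<ge> 0 \<Longrightarrow> p r ^ (k - 1) * (p r + real k / real n * q r) = c * (h r * G (r\<^sup>2) powr (- \<gamma>))"
proof -
  define \<Phi> where "\<Phi> u \<tau> = h \<tau> * u (\<tau>\<^sup>2) powr (- \<gamma>)" for u :: "real \<Rightarrow> real" and \<tau>
  define P where "P u r = (c * radial_mean n (\<Phi> u) r) powr (1 / real k)" for u r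
  define N where "N u s = P u (sqrt s) / 2" for u s
  define \<mu> where "\<mu> = (c * M) powr (1 / real k) / 2"
  define X where "X = {u. continuous_on {0..} u \<and> (\<forall>s\<ge>0. 1 \<le> u s \<and> u s \<le> 1 + \<mu> * s)}"
  have M: "M > 0" using h(2,3)[of 0] by simp
  have \<Phi>_cont: "continuous_on {0..} (\<Phi> u)" if "u \<in> X" for u
  proof -
    have "continuous_on {0..} (\<lambda>\<tau>. u (\<tau>\<^sup>2))"
      by (rule continuous_on_compose2[of "{0..}" u])
        (use that in \<open>auto simp: X_def intro!: continuous_on_power continuous_on_id\<close>)
    moreover have "u (\<tau>\<^sup>2) \<noteq> 0" for \<tau> using that by (auto simp: X_def dest!: spec[of _ "\<tau>\<^sup>2"])
    ultimately show ?thesis unfolding \<Phi>_def[abs_def]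
      by (intro continuous_on_mult h(1) continuous_on_powr continuous_on_const) auto
  qed
  have low: "\<exists>d>0. \<forall>r. 0 \<le> r \<and> r \<le> R \<longrightarrow> d \<le> h r" if "R \<ge> 0" for R
  proof -
    have "\<exists>x\<in>{0..R}. \<forall>y\<in>{0..R}. h x \<le> h y"
      using that by (intro continuous_attains_inf continuous_on_subset[OF h(1)]) auto
    then show ?thesis using h(2) by force
  qed
  have \<Phi>_le: "\<Phi> u \<tau> \<le> M" if "u \<in> X" "\<tau> \<ge> 0" for u \<tau>
  proof -
    have "1 \<le> u (\<tau>\<^sup>2)" using that by (simp add: X_def)
    then have "u (\<tau>\<^sup>2) powr (- \<gamma>) \<le> 1 powr (- \<gamma>)" using \<open>\<gamma> > 0\<close> by (intro powr_mono2') auto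
    then have "\<Phi> u \<tau> \<le> M * 1"
      unfolding \<Phi>_def using h(2,3)[OF that(2)] by (intro mult_mono) auto
    then show ?thesis by simp
  qed
  have \<Phi>_pos: "\<Phi> u \<tau> > 0" if "u \<in> X" "\<tau> \<ge> 0" for u \<tau>
    using that h(2) unfolding \<Phi>_def X_def by (force dest: spec[of _ "\<tau>\<^sup>2"])
  have mean_le: "radial_mean n (\<Phi> u) r \<le> M" if "u \<in> X" "r \<ge> 0" for u r
  proof -
    have "radial_mean n (\<Phi> u) r \<le> radial_mean n (\<lambda>_. M) r"
      using that by (intro radial_mean_mono \<Phi>_cont \<Phi>_le continuous_on_const) auto
    then show ?thesis using assms(1) by (simp add: radial_mean_const)
  qed
  have mean_pos: "radial_mean n (\<Phi> u) r > 0" if u: "u \<in> X" and r: "r \<ge> 0" for u r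
  proof -
    have "\<exists>x\<in>{0..r}. \<forall>y\<in>{0..r}. \<Phi> u x \<le> \<Phi> u y"
      using r by (intro continuous_attains_inf continuous_on_subset[OF \<Phi>_cont[OF u]]) auto
    then obtain x where x: "0 \<le> x" "\<And>y. 0 \<le> y \<Longrightarrow> y \<le> r \<Longrightarrow> \<Phi> u x \<le> \<Phi> u y" by auto
    have "radial_mean n (\<lambda>_. \<Phi> u x) r \<le> radial_mean n (\<Phi> u) r"
      using x r by (intro radial_mean_mono \<Phi>_cont[OF u] continuous_on_const) auto
    then show ?thesis using \<Phi>_pos[OF u x(1)] assms(1) by (simp add: radial_mean_const)
  qed
  have P_cont: "continuous_on {0..} (P u)" if "u \<in> X" for u
  proof -
    have "c * radial_mean n (\<Phi> u) r \<noteq> 0" if "r \<in> {0..}" for r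
      using mean_pos[OF \<open>u \<in> X\<close>, of r] that \<open>c > 0\<close> by simp
    then show ?thesis unfolding P_def[abs_def]
      by (intro continuous_on_powr continuous_on_mult continuous_on_const
          continuous_on_radial_mean \<Phi>_cont that) auto
  qed
  have N_cont: "continuous_on {0..} (N u)" if "u \<in> X" for u
    unfolding N_def[abs_def]
    by (intro continuous_on_divide continuous_on_const continuous_on_compose2[OF P_cont[OF that]]
        continuous_on_real_sqrt continuous_on_id) auto
  have N_bounds: "0 \<le> N u s \<and> N u s \<le> \<mu>" if "u \<in> X" "s \<ge> 0" for u s
    unfolding N_def \<mu>_def P_def
    using mean_le[OF that(1), of "sqrt s"] mean_pos[OF that(1), of "sqrt s"] that(2) \<open>c > 0\<close>
    by (auto intro!: powr_mono2 divide_right_mono mult_left_mono)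
  have self: "(\<lambda>s. 1 + integral {0..s} (N u)) \<in> X" if u: "u \<in> X" for u
  proof -
    have c: "continuous_on {0..s} (N u)" for s
      by (rule continuous_on_subset[OF N_cont[OF u]]) auto
    have "continuous_on {0..} (\<lambda>s. 1 + integral {0..s} (N u))"
      by (rule continuous_on_atLeast0I)
        (intro continuous_on_add continuous_on_const indefinite_integral_continuous_1 integrable_continuous_real c)
    moreover have "0 \<le> integral {0..s} (N u)" if "s \<ge> 0" for s
      using N_bounds[OF u] by (intro integral_nonneg integrable_continuous_real c) auto
    moreover have "integral {0..s} (N u) \<le> \<mu> * s" if "s \<ge> 0" for s
    proof -
      have "integral {0..s} (N u) \<le> integral {0..s} (\<lambda>_. \<mu>)"
        using N_bounds[OF u] by (intro integral_le integrable_continuous_real c continuous_on_const) auto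
      then show ?thesis using that by (simp add: mult.commute)
    qed
    ultimately show ?thesis by (simp add: X_def)
  qed
  have \<mu>: "\<mu> \<ge> 0" by (simp add: \<mu>_def)
  have "\<exists>G. G \<in> X \<and> (\<forall>s\<ge>0. G s = 1 + integral {0..s} (N G))"
  proof (rule volterra_fixed_point[of 1 "\<lambda>s. 1 + \<mu> * s" N, folded X_def])
    fix R :: real assume R: "R > 0"
    obtain d where d: "d > 0" "\<And>r. 0 \<le> r \<Longrightarrow> r \<le> sqrt R \<Longrightarrow> d \<le> h r"
      using low[of "sqrt R"] R by auto
    define L where "L = (1 / real k) * (c * (d * (1 + \<mu> * R) powr (- \<gamma>))) powr (1 / real k - 1) * c * M * \<gamma> / 2"
    have "L \<ge> 0" using \<open>c > 0\<close> M \<open>\<gamma> > 0\<close> by (simp add: L_def)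
    moreover have "\<bar>N u s - N v s\<bar> \<le> L * C * s ^ m"
      if uv: "u \<in> X" "v \<in> X" and C: "C \<ge> 0" and "\<forall>s\<in>{0..R}. \<bar>u s - v s\<bar> \<le> C * s ^ m" and s: "s \<in> {0..R}" for u v C m s
    proof -
      have le: "w s \<le> 1 + \<mu> * R" if "w \<in> X" "0 \<le> s" "s \<le> R" for w s
      proof -
        have "w s \<le> 1 + \<mu> * s" using that by (simp add: X_def)
        also have "\<dots> \<le> 1 + \<mu> * R" using that \<mu> by (intro add_left_mono mult_left_mono)
        finally show ?thesis .
      qed
      have "\<bar>P u (sqrt s) - P v (sqrt s)\<bar> \<le> (1 / real k) * (c * (d * (1 + \<mu> * R) powr (- \<gamma>))) powr (1 / real k - 1) * c * M * \<gamma> * C * s ^ m"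
        unfolding P_def \<Phi>_def
      proof (rule mean_kernel_lipschitz[where R = R])
        show "\<And>s. 0 \<le> s \<Longrightarrow> s \<le> R \<Longrightarrow> \<bar>u s - v s\<bar> \<le> C * s ^ m" using that by auto
        show "\<And>s. 0 \<le> s \<Longrightarrow> 1 \<le> u s" "\<And>s. 0 \<le> s \<Longrightarrow> 1 \<le> v s" "continuous_on {0..} u" "continuous_on {0..} v"
          using uv by (auto simp: X_def)
      qed (use assms R C d le uv s in auto)
      then show ?thesis by (simp add: N_def L_def flip: diff_divide_distrib)
    qed
    ultimately show "\<exists>L\<ge>0. \<forall>u\<in>X. \<forall>v\<in>X. \<forall>C\<ge>0. \<forall>m.
       (\<forall>s\<in>{0..R}. \<bar>u s - v s\<bar> \<le> C * s ^ m) \<longrightarrow> (\<forall>s\<in>{0..R}. \<bar>N u s - N v s\<bar> \<le> L * C * s ^ m)"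
      by blast
  next
    fix u assume "u \<in> X" "\<And>s. s \<ge> 0 \<Longrightarrow> u s = 1 + integral {0..s} (N u)"
    then show ?thesis by blast
  qed (use N_cont self \<mu> in auto)
  then obtain G where G: "G \<in> X" "\<And>s. s \<ge> 0 \<Longrightarrow> G s = 1 + integral {0..s} (N G)" by blast
  define A where "A = radial_mean n (\<Phi> G)"
  define p where "p = P G"
  \<comment> \<open>\<open>q r\<close> is \<open>r\<close> times the derivative of \<open>p\<close>, in a form that extends continuously by \<open>0\<close> to \<open>r = 0\<close>.\<close>
  define q where "q r = c * (real n * (\<Phi> G r - A r)) / (real k * p r ^ (k - 1))" for r
  have A: "c * A r > 0" if "r \<ge> 0" for r using mean_pos[OF G(1) that] \<open>c > 0\<close> by (simp add: A_def)
  have p_pos: "p r > 0" if "r \<ge> 0" for r using A[OF that] by (auto simp: p_def P_def A_def)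
  have p_pow: "p r ^ k = c * A r" if "r \<ge> 0" for r
    using A[OF that] p_pos[OF that] \<open>k \<ge> 1\<close>
    by (simp add: p_def P_def A_def powr_realpow[symmetric] powr_powr)
  show thesis
  proof (rule that)
    show "1 \<le> G s" if "s \<ge> 0" for s using G(1) that by (simp add: X_def)
    show "(G has_real_derivative p (sqrt s) / 2) (at s within {0..})" if s: "s \<ge> 0" for s
    proof -
      have "((\<lambda>s. integral {0..s} (N G)) has_real_derivative N G s) (at s within {0..s + 1})"
        using s by (intro integral_has_real_derivative continuous_on_subset[OF N_cont[OF G(1)]]) auto
      moreover have "at s within {0..s + 1} = at s within {0..}"
        by (rule at_within_nhd[of _ "{..<s + 1}"]) auto
      ultimately have "((\<lambda>s. 1 + integral {0..s} (N G)) has_real_derivative p (sqrt s) / 2) (at s within {0..})"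
        by (auto intro!: derivative_eq_intros simp: N_def p_def)
      then show ?thesis
        by (rule has_field_derivative_transform_within[of _ _ _ _ 1]) (use s G(2) in auto)
    qed
    show "continuous_on {0..} p" unfolding p_def by (rule P_cont[OF G(1)])
    show "p r > 0" if "r \<ge> 0" for r by (rule p_pos[OF that])
    show "(p has_real_derivative q r / r) (at r)" if r: "r > 0" for r
    proof -
      have "(A has_real_derivative real n * (\<Phi> G r - A r) / r) (at r)"
        unfolding A_def using r assms(1) by (intro DERIV_radial_mean \<Phi>_cont[OF G(1)]) auto
      from DERIV_cmult[OF this, of c]
      have "((\<lambda>r. c * A r) has_real_derivative c * (real n * (\<Phi> G r - A r) / r)) (at r)" .
      from DERIV_chain2[OF has_real_derivative_powr[OF A, of r "1 / real k"] this]
      have "(p has_real_derivative (1 / real k) * (c * A r) powr (1 / real k - 1) * (c * (real n * (\<Phi> G r - A r) / r))) (at r)"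
        using r by (simp add: p_def P_def[abs_def] A_def)
      moreover have "(c * A r) powr (1 / real k - 1) = 1 / p r ^ (k - 1)"
      proof -
        have "(c * A r) powr (1 / real k - 1) = p r / p r ^ k"
          using A[of r] r p_pow[of r] by (simp add: powr_diff p_def P_def A_def)
        then show ?thesis using p_pos[of r] r \<open>k \<ge> 1\<close> by (cases k) auto
      qed
      ultimately show ?thesis by (simp add: q_def mult_ac)
    qed
    show "continuous_on {0..} q"
    proof -
      have "real k * p r ^ (k - 1) \<noteq> 0" if "r \<in> {0..}" for r
        using p_pos[of r] that \<open>k \<ge> 1\<close> by simp
      then show ?thesis
        unfolding q_def[abs_def] A_def p_def
        by (intro continuous_on_divide continuous_on_mult continuous_on_const continuous_on_diff
            continuous_on_power \<Phi>_cont[OF G(1)] continuous_on_radial_mean P_cont[OF G(1)]) auto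
    qed
    show "q 0 = 0" using assms(1) by (simp add: q_def A_def radial_mean_0)
    show "p r ^ (k - 1) * (p r + real k / real n * q r) = c * (h r * G (r\<^sup>2) powr (- \<gamma>))" if r: "r \<ge> 0" for r
    proof -
      have "p r ^ (k - 1) * p r = c * A r"
        using p_pow[OF r] \<open>k \<ge> 1\<close> by (cases k) (auto simp: mult.commute)
      moreover have "p r ^ (k - 1) * (real k / real n * q r) = c * (\<Phi> G r - A r)"
        using p_pos[OF r] assms(1,2) by (simp add: q_def)
      ultimately have "p r ^ (k - 1) * (p r + real k / real n * q r) = c * \<Phi> G r"
        by (simp add: algebra_simps)
      then show ?thesis by (simp add: \<Phi>_def)
    qed
  qed
qed

section \<open>The time factor\<close>

lemma at_within_atMost_ne_bot:
  fixes t a :: real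
  assumes "t \<le> a"
  shows "at t within {..a} \<noteq> bot"
proof
  assume "at t within {..a} = bot"
  moreover have "at_left t \<le> at t within {..a}" using assms by (intro at_le) auto
  ultimately show False using trivial_limit_at_left_real[of t] by (simp add: bot_unique)
qed

text \<open>
  The equation \<open>-w' w\<^sup>m = g\<close> integrates to \<open>w\<^bsup>m+1\<^esup> = 1 + (m + 1) \<integral>\<^sub>t\<^sup>0 g\<close>; the constant \<open>1\<close> keeps \<open>w\<close> positive
  up to \<open>t = 0\<close>.
\<close>
lemma backward_power_ode_solution:
  fixes g :: "real \<Rightarrow> real" and m :: real
  assumes g: "continuous_on {..0} g" "\<And>t. t \<le> 0 \<Longrightarrow> g t > 0" and m: "m > 0"
  obtains w where "\<And>t. t \<le> 0 \<Longrightarrow> w t > 0"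
    "\<And>t. t \<le> 0 \<Longrightarrow> (w has_real_derivative - (g t / w t powr m)) (at t within {..0})"
proof -
  define E where "E t = 1 + (m + 1) * integral {t..0} g" for t
  define w where "w t = E t powr (1 / (m + 1))" for t
  have E: "E t \<ge> 1" if "t \<le> 0" for t
  proof -
    have "0 \<le> integral {t..0} g"
      using g(2) by (intro integral_nonneg integrable_continuous_real continuous_on_subset[OF g(1)]) (auto intro: less_imp_le)
    then show ?thesis using m by (simp add: E_def)
  qed
  have w_pos: "w t > 0" if "t \<le> 0" for t using E[OF that] by (simp add: w_def)
  have "(w has_real_derivative - (g t / w t powr m)) (at t within {..0})" if t: "t \<le> 0" for t
  proof -
    have "((\<lambda>t. integral {t..0} g) has_real_derivative - g t) (at t within {t - 1..0})"
      using t by (intro integral_has_real_derivative' continuous_on_subset[OF g(1)]) auto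
    moreover have "at t within {t - 1..0} = at t within {..0}"
      by (rule at_within_nhd[of _ "{t - 1<..}"]) auto
    ultimately have "(E has_real_derivative (m + 1) * - g t) (at t within {..0})"
      unfolding E_def[abs_def] by (auto intro!: derivative_eq_intros)
    from DERIV_chain2[OF has_real_derivative_powr[of "E t" "1 / (m + 1)"] this]
    have "(w has_real_derivative 1 / (m + 1) * E t powr (1 / (m + 1) - 1) * ((m + 1) * - g t)) (at t within {..0})"
      using E[OF t] unfolding w_def[abs_def] by simp
    moreover have "E t powr (1 / (m + 1) - 1) = 1 / w t powr m"
    proof -
      have "1 / (m + 1) - 1 = - (1 / (m + 1) * m)" using m by (simp add: field_simps)
      then show ?thesis using E[OF t] by (simp add: w_def powr_powr powr_minus_divide)
    qed
    ultimately show ?thesis using m by simp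
  qed
  with w_pos show thesis by (rule that)
qed

lemma strict_antimono_on_of_neg_deriv:
  fixes w w' :: "real \<Rightarrow> real"
  assumes "\<And>t. t \<le> 0 \<Longrightarrow> (w has_real_derivative w' t) (at t within {..0})" "\<And>t. t \<le> 0 \<Longrightarrow> w' t < 0"
  shows "strict_antimono_on {..0} w"
proof (rule monotone_onI)
  fix s t :: real
  assume st: "s \<in> {..0}" "t \<in> {..0}" "s < t"
  have "continuous_on {s..t} w"
    using st by (intro DERIV_continuous_on[where D = w'] DERIV_subset[OF assms(1)]) auto
  moreover have "(w has_real_derivative w' x) (at x)" if "s < x" "x < t" for x
  proof -
    have "at x within {..0} = at x" using that st by (intro at_within_open_subset[of x "{..<0}"]) auto
    then show ?thesis using assms(1)[of x] that st by simp
  qed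
  ultimately show "w t < w s"
    using st assms(2) by (intro DERIV_neg_imp_decreasing_open[OF st(3)]) fastforce+
qed

section \<open>Separated solutions\<close>

text \<open>
  For \<open>j \<le> k\<close> the factor \<open>p + (j/n) q\<close> of \<open>\<sigma>\<^sub>j\<close> is a convex combination of \<open>p\<close> and
  \<open>p + (k/n) q\<close>; so \<open>p > 0\<close> and \<open>\<sigma>\<^sub>k > 0\<close> give \<open>k\<close>-convexity.
\<close>
lemma hessian_scaled_radial:
  fixes G p q :: "real \<Rightarrow> real" and w :: real
  assumes w: "w > 0"
    and G: "\<And>s. s \<ge> 0 \<Longrightarrow> (G has_real_derivative p (sqrt s) / 2) (at s within {0..})"
    and p: "continuous_on {0..} p" "\<And>r. r > 0 \<Longrightarrow> (p has_real_derivative q r / r) (at r)" "\<And>r. r \<ge> 0 \<Longrightarrow> p r > 0"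
    and q: "continuous_on {0..} q" "q 0 = 0"
    and k: "1 \<le> k" "k \<le> CARD('n::finite)"
    and pos: "\<And>r. r \<ge> 0 \<Longrightarrow> p r + real k / real (CARD('n)) * q r > 0"
  shows "k_convex k (\<lambda>x::real^'n. w * G ((norm x)\<^sup>2))"
    and "elem_sym k (eigenvalues (hessian (\<lambda>x::real^'n. w * G ((norm x)\<^sup>2)) x))
      = w ^ k * (real (CARD('n) choose k) * p (norm x) ^ (k - 1) * (p (norm x) + real k / real (CARD('n)) * q (norm x)))"
proof -
  let ?V = "\<lambda>x::real^'n. w * G ((norm x)\<^sup>2)"
  have G': "((\<lambda>s. w * G s) has_real_derivative (w * p (sqrt s)) / 2) (at s within {0..})" if "s \<ge> 0" for s
    using DERIV_cmult[OF G[OF that], of w] by simp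
  have p': "((\<lambda>r. w * p r) has_real_derivative (w * q r) / r) (at r)" if "r > 0" for r
    using DERIV_cmult[OF p(2)[OF that], of w] by simp
  note R = radial_C2[where 'n = 'n, of "\<lambda>s. w * G s" "\<lambda>r. w * p r" "\<lambda>r. w * q r",
      OF G' continuous_on_mult_left[OF p(1)] p' continuous_on_mult_left[OF q(1)]]
  have C: "C2 ?V" using q(2) by (intro R(1)) auto
  have H: "hessian ?V x = mat (w * p (norm x)) + (w * q (norm x)) *\<^sub>R outer (sgn x)" for x
    using q(2) by (intro R(2)) auto
  have \<sigma>: "elem_sym j (eigenvalues (hessian ?V x)) = w ^ j * (real (CARD('n) choose j) * p (norm x) ^ (j - 1) *
      (p (norm x) + real j / real (CARD('n)) * q (norm x)))" if j: "1 \<le> j" for j x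
  proof -
    obtain i where "j = Suc i" using j by (cases j) auto
    then show ?thesis
      unfolding H using q(2) by (subst elem_sym_radial_hessian) (auto simp: power_mult_distrib algebra_simps)
  qed
  show "elem_sym k (eigenvalues (hessian ?V x))
      = w ^ k * (real (CARD('n) choose k) * p (norm x) ^ (k - 1) * (p (norm x) + real k / real (CARD('n)) * q (norm x)))"
    by (rule \<sigma>[OF k(1)])
  have "elem_sym j (eigenvalues (hessian ?V x)) > 0" if j: "1 \<le> j" "j \<le> k" for j x
  proof -
    let ?p = "p (norm x)" and ?q = "q (norm x)" and ?n = "real (CARD('n))"
    define c where "c = real j / real k"
    have c: "0 < c" "c \<le> 1" using j k by (auto simp: c_def)
    have "?p + real j / ?n * ?q = (1 - c) * ?p + c * (?p + real k / ?n * ?q)"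
      using k(1) by (simp add: c_def field_simps)
    also have "\<dots> > 0"
      using c p(3)[of "norm x"] pos[of "norm x"] by (intro add_nonneg_pos[OF mult_nonneg_nonneg mult_pos_pos]) auto
    finally show ?thesis
      unfolding \<sigma>[OF j(1)] using w p(3)[of "norm x"] j k by (intro mult_pos_pos zero_less_power) auto
  qed
  then show "k_convex k ?V" using C by (simp add: k_convex_def)
qed

text \<open>
  For \<open>u = w v\<close> the equation separates into \<open>-w' w\<^bsup>k \<alpha>\<^esup> = g\<close> and \<open>v \<sigma>\<^sub>k(D\<^sup>2v)\<^bsup>\<alpha>\<^esup> = f\<close>.  As \<open>\<alpha> > 0\<close>, the
  second one reads \<open>\<sigma>\<^sub>k = f\<^bsup>1/\<alpha>\<^esup> v\<^bsup>-1/\<alpha>\<^esup>\<close> with a right-hand side that decreases in \<open>v\<close>.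
\<close>
lemma separated_solution_exists:
  fixes k :: nat and \<alpha> :: real and f g :: "real \<Rightarrow> real"
  assumes k: "1 \<le> k" "k \<le> CARD('n::finite)"
    and f: "continuous_on {0..} f" "\<And>r. r \<ge> 0 \<Longrightarrow> f r > 0" "bdd_above (f ` {0..})"
    and g: "continuous_on {..0} g" "\<And>t. t \<le> 0 \<Longrightarrow> g t > 0"
    and \<alpha>: "\<alpha> > 0"
  shows "\<exists>w v. strict_antimono_on {..0} w \<and>
               k_convex k (\<lambda>x::real^'n. v (norm x)) \<and>
               (\<forall>x::real^'n. \<forall>t\<le>0. separated w v x t > 0) \<and>
               parabolically_k_convex k (separated w v :: real^'n \<Rightarrow> real \<Rightarrow> real) \<and>
               classical_solution k \<alpha> f g (separated w v :: real^'n \<Rightarrow> real \<Rightarrow> real)"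
proof -
  let ?n = "CARD('n)"
  let ?C = "real (?n choose k)"
  have C: "?C > 0" using k by simp
  obtain M where M: "\<And>r. r \<ge> 0 \<Longrightarrow> f r \<le> M" using f(3) by (auto simp: bdd_above_def)
  define h where "h r = f r powr (1 / \<alpha>)" for r
  have h_cont: "continuous_on {0..} h"
    unfolding h_def[abs_def] using f(2) by (intro continuous_on_powr f(1) continuous_on_const) force
  have h_pos: "h r > 0" if "r \<ge> 0" for r using f(2)[OF that] by (simp add: h_def)
  have h_le: "h r \<le> M powr (1 / \<alpha>)" if "r \<ge> 0" for r
    unfolding h_def using f(2)[OF that] M[OF that] \<alpha> by (intro powr_mono2) auto
  have "?n \<ge> 1" "1 / ?C > 0" "1 / \<alpha> > 0" using C \<alpha> by (auto simp: Suc_le_eq)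
  from radial_profile_exists[OF this(1) k(1) this(2,3) h_cont h_pos h_le]
  obtain G p q where G1: "\<And>s. s \<ge> 0 \<Longrightarrow> 1 \<le> G s"
    and G: "\<And>s. s \<ge> 0 \<Longrightarrow> (G has_real_derivative p (sqrt s) / 2) (at s within {0..})"
    and p: "continuous_on {0..} p" "\<And>r. r > 0 \<Longrightarrow> (p has_real_derivative q r / r) (at r)" "\<And>r. r \<ge> 0 \<Longrightarrow> p r > 0"
    and q: "continuous_on {0..} q" "q 0 = 0"
    and eq: "\<And>r. r \<ge> 0 \<Longrightarrow> p r ^ (k - 1) * (p r + real k / real ?n * q r)
        = 1 / ?C * (h r * G (r\<^sup>2) powr (- (1 / \<alpha>)))"
    by metis
  have pos: "p r + real k / real ?n * q r > 0" if "r \<ge> 0" for r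
  proof -
    have "1 / ?C * (h r * G (r\<^sup>2) powr (- (1 / \<alpha>))) > 0"
      using C h_pos[OF that] G1[of "r\<^sup>2"] by simp
    then have "p r ^ (k - 1) * (p r + real k / real ?n * q r) > 0" using eq[OF that] by simp
    then show ?thesis using p(3)[OF that] by (simp add: zero_less_mult_iff)
  qed
  have "real k * \<alpha> > 0" using k \<alpha> by simp
  from backward_power_ode_solution[OF g this]
  obtain w where w: "\<And>t. t \<le> 0 \<Longrightarrow> w t > 0"
    and w': "\<And>t. t \<le> 0 \<Longrightarrow> (w has_real_derivative - (g t / w t powr (real k * \<alpha>))) (at t within {..0})"
    by metis
  define v where "v r = G (r\<^sup>2)" for r
  let ?u = "separated w v :: real^'n \<Rightarrow> real \<Rightarrow> real"
  have v1: "v r \<ge> 1" for r by (simp add: v_def G1)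
  have w_cont: "continuous_on {..0} w"
    using w' by (intro DERIV_continuous_on) auto
  note hess = hessian_scaled_radial[where 'n = 'n, OF _ G p q k pos]
  have slice: "(\<lambda>x. ?u x t) = (\<lambda>x. w t * G ((norm x)\<^sup>2))" for t
    by (simp add: separated_def v_def fun_eq_iff)
  have kc: "k_convex k (\<lambda>x. ?u x t)" if "t \<le> 0" for t
    unfolding slice by (rule hess(1)[OF w[OF that]])
  have \<sigma>: "elem_sym k (eigenvalues (hessian (\<lambda>y. ?u y t) x)) = w t ^ k * (h (norm x) * v (norm x) powr (- (1 / \<alpha>)))" if "t \<le> 0" for t x
  proof -
    let ?p = "p (norm x)" and ?q = "q (norm x)"
    have "elem_sym k (eigenvalues (hessian (\<lambda>y. ?u y t) x))
        = w t ^ k * (?C * ?p ^ (k - 1) * (?p + real k / real ?n * ?q))"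
      unfolding slice by (rule hess(2)[OF w[OF that]])
    also have "?C * ?p ^ (k - 1) * (?p + real k / real ?n * ?q)
        = ?C * (1 / ?C * (h (norm x) * v (norm x) powr (- (1 / \<alpha>))))"
      using eq[of "norm x"] by (simp only: mult.assoc v_def norm_ge_zero)
    also have "\<dots> = h (norm x) * v (norm x) powr (- (1 / \<alpha>))"
      using C by simp
    finally show ?thesis .
  qed
  have u': "((?u x) has_real_derivative - (g t / w t powr (real k * \<alpha>)) * v (norm x)) (at t within {..0})" if "t \<le> 0" for x t
    unfolding separated_def[abs_def] by (rule DERIV_cmult_right[OF w'[OF that]])
  have td: "time_deriv ?u x t = - (g t / w t powr (real k * \<alpha>)) * v (norm x)" if t: "t \<le> 0" for x t
    unfolding time_deriv_def using u'[OF t] at_within_atMost_ne_bot[OF t]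
    by (intro vector_derivative_within) (simp_all add: has_real_derivative_iff_has_vector_derivative)
  have anti: "strict_antimono_on {..0} w"
  proof (rule strict_antimono_on_of_neg_deriv[OF w'])
    show "- (g t / w t powr (real k * \<alpha>)) < 0" if "t \<le> 0" for t
      using g(2)[OF that] w[OF that] by simp
  qed
  have u_anti: "strict_antimono_on {..0} (?u x)" for x
    using anti order.strict_trans2[OF zero_less_one v1[of "norm x"]]
    by (auto simp: monotone_on_def separated_def)
  have u_pos: "?u x t > 0" if "t \<le> 0" for x t
    using w[OF that] order.strict_trans2[OF zero_less_one v1[of "norm x"]] by (simp add: separated_def)
  have "classical_solution k \<alpha> f g ?u"
    unfolding classical_solution_def
  proof (intro conjI allI impI)
    show "C2 (\<lambda>x. ?u x t)" if "t \<le> 0" for t using kc[OF that] by (simp add: k_convex_def)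
    show "?u x differentiable_on {..0}" for x
      unfolding differentiable_on_def differentiable_def
      using u' by (auto simp: has_field_derivative_def)
    show "continuous_on {..0} (time_deriv ?u x)" for x
    proof -
      have "continuous_on {..0} (\<lambda>t. - (g t / w t powr (real k * \<alpha>)) * v (norm x))"
        using w by (intro continuous_on_mult continuous_on_minus continuous_on_divide g(1)
            continuous_on_powr w_cont continuous_on_const) force+
      then show ?thesis by (rule continuous_on_cong[THEN iffD1, rotated -1]) (auto simp: td)
    qed
    show "- time_deriv ?u x t * elem_sym k (eigenvalues (hessian (\<lambda>y. ?u y t) x)) powr \<alpha> = f (norm x) * g t"
      if t: "t \<le> 0" for x t
    proof -
      have v: "v (norm x) > 0" using v1[of "norm x"] by simp
      have "(w t ^ k * (h (norm x) * v (norm x) powr (- (1 / \<alpha>)))) powr \<alpha>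
          = (w t ^ k) powr \<alpha> * (h (norm x) powr \<alpha> * (v (norm x) powr (- (1 / \<alpha>))) powr \<alpha>)"
        using w[OF t] h_pos[of "norm x"] by (simp add: powr_mult)
      moreover have "(w t ^ k) powr \<alpha> = w t powr (real k * \<alpha>)"
        using w[OF t] by (simp add: powr_realpow[symmetric] powr_powr)
      moreover have "h (norm x) powr \<alpha> = f (norm x)"
        using f(2)[of "norm x"] \<alpha> by (simp add: h_def powr_powr)
      moreover have "(v (norm x) powr (- (1 / \<alpha>))) powr \<alpha> = 1 / v (norm x)"
        using v \<alpha> by (subst powr_powr) (simp add: powr_minus_divide)
      ultimately show ?thesis
        using v w[OF t] by (simp add: td[OF t] \<sigma>[OF t])
    qed
  qed
  moreover have "parabolically_k_convex k ?u"
    using u_anti kc by (simp add: parabolically_k_convex_def)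
  moreover have "k_convex k (\<lambda>x::real^'n. v (norm x))"
    using hess(1)[of 1] by (simp add: v_def)
  ultimately show ?thesis using anti u_pos by blast
qed

text \<open>
  The equation at time \<open>0\<close> alone is contradictory.  Since \<open>u\<^sub>t(x, 0)\<close> is a constant multiple of
  \<open>V = u(x, 0)\<close>, it reads \<open>d V \<sigma>\<^sub>k(D\<^sup>2V)\<^bsup>\<alpha>\<^esup> = f g(0)\<close>, and as \<open>\<alpha> < 0\<close> and \<open>f \<le> M\<close> this gives
  \<open>\<sigma>\<^sub>k(D\<^sup>2V) \<ge> K V\<^bsup>\<beta>\<^esup>\<close> with \<open>\<beta> = -1/\<alpha>\<close>, where \<open>\<beta> > k\<close> says precisely that \<open>\<alpha> > -1/k\<close>.
\<close>
lemma no_separated_solution: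
  fixes k :: nat and \<alpha> :: real and f g w v :: "real \<Rightarrow> real"
  assumes k: "1 \<le> k" "k \<le> CARD('n::finite)"
    and f: "\<And>r. r \<ge> 0 \<Longrightarrow> f r > 0" "bdd_above (f ` {0..})"
    and g: "g 0 > 0"
    and \<alpha>: "- 1 / real k < \<alpha>" "\<alpha> < 0"
    and pos: "\<And>x::real^'n. \<And>t. t \<le> 0 \<Longrightarrow> separated w v x t > 0"
    and conv: "parabolically_k_convex k (separated w v :: real^'n \<Rightarrow> real \<Rightarrow> real)"
    and sol: "classical_solution k \<alpha> f g (separated w v :: real^'n \<Rightarrow> real \<Rightarrow> real)"
  shows False
proof -
  let ?u = "separated w v :: real^'n \<Rightarrow> real \<Rightarrow> real"
  define \<phi> where "\<phi> r = w 0 * v r" for r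
  define V where "V = (\<lambda>x::real^'n. \<phi> (norm x))"
  have slice: "(\<lambda>x. ?u x 0) = V" by (simp add: V_def \<phi>_def separated_def fun_eq_iff)
  have V_pos: "V x > 0" for x using pos[of 0 x] by (simp add: V_def \<phi>_def separated_def)
  have w0: "w 0 \<noteq> 0" and v: "v (norm x) \<noteq> 0" for x :: "real^'n"
    using V_pos[of x] by (auto simp: V_def \<phi>_def)
  have kc: "k_convex k V" using conv slice by (auto simp: parabolically_k_convex_def)
  define D where "D = vector_derivative w (at 0 within {..0})"
  have td: "time_deriv ?u x 0 = D * v (norm x)" for x
  proof -
    have nb: "at (0::real) within {..0} \<noteq> bot"
      by (rule at_within_atMost_ne_bot) simp
    have "?u x differentiable (at 0 within {..0})"
      using sol by (auto simp: classical_solution_def differentiable_on_def)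
    then obtain d where d: "(?u x has_real_derivative d) (at 0 within {..0})"
      by (metis real_differentiable_def)
    have "((\<lambda>t. ?u x t / v (norm x)) has_real_derivative d / v (norm x)) (at 0 within {..0})"
      by (rule DERIV_cdivide[OF d])
    then have "(w has_real_derivative d / v (norm x)) (at 0 within {..0})"
      using v[of x] by (simp add: separated_def)
    then have "D = d / v (norm x)"
      unfolding D_def by (intro vector_derivative_within nb) (simp add: has_real_derivative_iff_has_vector_derivative)
    moreover have "time_deriv ?u x 0 = d"
      unfolding time_deriv_def using d by (intro vector_derivative_within nb) (simp add: has_real_derivative_iff_has_vector_derivative)
    ultimately show ?thesis using v[of x] by simp
  qed
  \<comment> \<open>Positivity of \<open>w v\<close> does not decide the sign of \<open>w 0\<close>; that of the quotient \<open>d\<close> follows from the equation.\<close>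
  define d where "d = - D / w 0"
  define S where "S x = elem_sym k (eigenvalues (hessian V x))" for x
  have S_pos: "S x > 0" for x using kc k by (auto simp: k_convex_def S_def)
  have eq: "d * V x * S x powr \<alpha> = f (norm x) * g 0" for x
  proof -
    have "- time_deriv ?u x 0 * S x powr \<alpha> = f (norm x) * g 0"
      using sol unfolding classical_solution_def S_def slice[symmetric] by blast
    moreover have "- time_deriv ?u x 0 = d * V x"
      using w0 by (simp add: td d_def V_def \<phi>_def)
    ultimately show ?thesis by simp
  qed
  have d: "d > 0"
  proof -
    have "d * V 0 * S 0 powr \<alpha> > 0" unfolding eq using f(1)[of 0] g by simp
    then show ?thesis using V_pos[of 0] by (simp add: zero_less_mult_iff)
  qed
  obtain M where M: "\<And>r. r \<ge> 0 \<Longrightarrow> f r \<le> M" using f(2) by (auto simp: bdd_above_def)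
  have M_pos: "M > 0" using M[of 0] f(1)[of 0] by simp
  define \<beta> where "\<beta> = - 1 / \<alpha>"
  have \<beta>: "\<beta> > real k" using \<alpha> k by (simp add: \<beta>_def field_simps)
  define K where "K = (d / (M * g 0)) powr \<beta>"
  have K: "K > 0" using d M_pos g by (simp add: K_def)
  have super: "S x \<ge> K * V x powr \<beta>" for x
  proof -
    have "f (norm x) * g 0 \<le> M * g 0" using M g by (intro mult_right_mono) auto
    then have "S x powr \<alpha> * (d * V x) \<le> M * g 0" using eq[of x] by (simp add: mult_ac)
    then have "S x powr \<alpha> \<le> M * g 0 / (d * V x)" using d V_pos[of x] by (simp add: pos_le_divide_eq)
    then have "(M * g 0 / (d * V x)) powr (1 / \<alpha>) \<le> (S x powr \<alpha>) powr (1 / \<alpha>)"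
      using \<alpha> S_pos[of x] by (intro powr_mono2') auto
    also have "\<dots> = S x" using \<alpha> S_pos[of x] by (simp add: powr_powr)
    finally have "(M * g 0 / (d * V x)) powr (1 / \<alpha>) \<le> S x" .
    moreover have "(M * g 0 / (d * V x)) powr (1 / \<alpha>) = K * V x powr \<beta>"
    proof -
      have "1 / \<alpha> = - \<beta>" by (simp add: \<beta>_def)
      then show ?thesis
        using M_pos g d V_pos[of x] by (simp add: K_def powr_minus powr_divide powr_mult)
    qed
    ultimately show ?thesis by simp
  qed
  show False
    by (rule no_entire_k_convex_radial_supersolution[OF k, of \<phi> K \<beta>])
      (use kc V_pos super K \<beta> in \<open>auto simp: V_def S_def\<close>)
qed

theorem theorem1p2:
  fixes k :: nat and \<alpha> :: real and f g :: "real \<Rightarrow> real"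
  assumes "1 \<le> k" and "k \<le> CARD('n::finite)"
    and "continuous_on {0..} f" and "\<forall>r\<ge>0. f r > 0" and "bdd_above (f ` {0..})"
    and "continuous_on {..0} g" and "\<forall>t\<le>0. g t > 0"
  shows
    "(\<alpha> > 0 \<longrightarrow>
        (\<exists>w v. strict_antimono_on {..0} w \<and>
               k_convex k (\<lambda>x::real^'n. v (norm x)) \<and>
               (\<forall>x::real^'n. \<forall>t\<le>0. separated w v x t > 0) \<and>
               parabolically_k_convex k (separated w v :: real^'n \<Rightarrow> real \<Rightarrow> real) \<and>
               classical_solution k \<alpha> f g (separated w v :: real^'n \<Rightarrow> real \<Rightarrow> real))) \<and>
     (- 1 / real k < \<alpha> \<and> \<alpha> < 0 \<longrightarrow>
        \<not> (\<exists>w v. (\<forall>x::real^'n. \<forall>t\<le>0. separated w v x t > 0) \<and>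
                 parabolically_k_convex k (separated w v :: real^'n \<Rightarrow> real \<Rightarrow> real) \<and>
                 classical_solution k \<alpha> f g (separated w v :: real^'n \<Rightarrow> real \<Rightarrow> real)))"
proof (intro conjI impI)
  assume "\<alpha> > 0"
  then show "\<exists>w v. strict_antimono_on {..0} w \<and>
               k_convex k (\<lambda>x::real^'n. v (norm x)) \<and>
               (\<forall>x::real^'n. \<forall>t\<le>0. separated w v x t > 0) \<and>
               parabolically_k_convex k (separated w v :: real^'n \<Rightarrow> real \<Rightarrow> real) \<and>
               classical_solution k \<alpha> f g (separated w v :: real^'n \<Rightarrow> real \<Rightarrow> real)"
    using assms by (intro separated_solution_exists) auto
next
  assume \<alpha>: "- 1 / real k < \<alpha> \<and> \<alpha> < 0"
  show "\<not> (\<exists>w v. (\<forall>x::real^'n. \<forall>t\<le>0. separated w v x t > 0) \<and>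
                 parabolically_k_convex k (separated w v :: real^'n \<Rightarrow> real \<Rightarrow> real) \<and>
                 classical_solution k \<alpha> f g (separated w v :: real^'n \<Rightarrow> real \<Rightarrow> real))"
    using no_separated_solution[OF assms(1,2), of f g \<alpha>] assms \<alpha> by blast
qed

end
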